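(* Let $(K,V_i)_{i=0}^{N-1}$ be a row co-isometry with Cuntz dilation $(H,S_i)_{i=0}^{N-1}$, and suppose that: (A1) there is a continuous map $e:\mathcal T\to K$, $t\mapsto e_t$, from a complete metric space $\mathcal T$, such that $\overline{\operatorname{span}}\{e_t:t\in\mathcal T\}=K$ and $\|e_t\|=1$ for all $t\in\mathcal T$; (A2) for every $i\in\{0,\dots,N-1\}$ and $t\in\mathcal T$, $V_i^*e_t=\nu_i(t)e_{g_i(t)}$ for some $\nu_i(t)\in\mathbb C$ and $g_i(t)\in\mathcal T$; (A3) the maps $g_i:\mathcal T\to\mathcal T$ are contractions. Then there are finitely many minimal compact invariant sets. If $M_1,\dots,M_p$ is the complete list of minimal compact invariant sets, then the spaces $K(M_j)$ are invariant for $V_i^*$, $i=0,\dots,N-1$, and the spaces $H(M_j)$ are invariant for the representation $(S_i)_{i=0}^{N-1}$. The spaces $H(M_j)$ are mutually orthogonal and $$\bigoplus_{j=1}^pH(M_j)=H.$$ The sub-representations $(S_i)_{i=0}^{N-1}$ on $H(M_j)$, $j=1,\dots,p$, are irreducible and (pairwise) disjoint.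
   Context: Row co-isometry: a Hilbert space $K$ with bounded operators $V_0,\dots,V_{N-1}$ on $K$ ($N\ge 2$) satisfying $\sum_{i=0}^{N-1}V_iV_i^*=I_K$. Representation of the Cuntz algebra $\mathcal O_N$: bounded operators $S_0,\dots,S_{N-1}$ on a Hilbert space $H$ with $\sum_iS_iS_i^*=I_H$ and $S_j^*S_i=\delta_{j,i}I_H$. A closed subspace is invariant for the representation if it is invariant under all $S_i$ and $S_i^*$. The representation is irreducible if its only closed invariant subspaces are $\{0\}$ and $H$. Two representations $(H,S_i)$, $(H',S_i')$ are disjoint if there is no non-zero bounded $W:H\to H'$ with $WS_i=S_i'W$ and $WS_i^*=S_i'^*W$ for all $i$. Cuntz dilation of $(K,V_i)$: the representation $(H,S_i)_{i=0}^{N-1}$ of $\mathcal O_N$, unique up to unitary equivalence, on a Hilbert space $H\supseteq K$ such that $K$ is cyclic for the representation, $S_i^*K\subseteq K$ and $V_i^*=S_i^*|_K$ (so $V_i=P_KS_i|_K$, $P_K$ being the orthogonal projection onto $K$) for all $i$. Its existence and uniqueness are known. $g:\mathcal T\to\mathcal T$ is a contraction if there is $0<c<1$ with $d(g(x),g(y))\le c\,d(x,y)$ for all $x,y$. $\Omega$ is the set of all finite words over $\{0,\dots,N-1\}$ including the empty word; for $\omega=\omega_1\cdots\omega_n$, $S_\omega=S_{\omega_1}\cdots S_{\omega_n}$, $S_\emptyset=I$. The transition $t\to g_i(t)$ is possible if $\nu_i(t)\ne0$. A subset $M\subseteq\mathcal T$ is invariant if for all $t\in M$ and $i$, $\nu_i(t)\neq0$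 implies $g_i(t)\in M$. A nonempty closed invariant set is minimal if it has no nonempty proper closed invariant subset; a minimal compact invariant set is a compact invariant set that is minimal. For an invariant set $M$: $K(M)=\overline{\operatorname{span}}\{e_t:t\in M\}\subseteq K$ and $H(M)=\overline{\operatorname{span}}\{S_\omega e_t:t\in M,\omega\in\Omega\}\subseteq H$. *)

theory Defs
  imports "HOL-Analysis.Analysis"
begin

text \<open>The inner product is linear in the first and conjugate-linear in the second argument.
  Norm and topology are those of the underlying real inner product space, whose inner product
  is the real part of the complex one.\<close>

class complex_inner = real_inner +
  fixes scaleC :: "complex \<Rightarrow> 'a \<Rightarrow> 'a" (infixr "*\<^sub>C" 75)
    and cinner :: "'a \<Rightarrow> 'a \<Rightarrow> complex"
  assumes scaleC_add_right: "a *\<^sub>C (x + y) = a *\<^sub>C x + a *\<^sub>C y"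
    and scaleC_add_left: "(a + b) *\<^sub>C x = a *\<^sub>C x + b *\<^sub>C x"
    and scaleC_scaleC: "a *\<^sub>C b *\<^sub>C x = (a * b) *\<^sub>C x"
    and scaleC_of_real: "complex_of_real r *\<^sub>C x = r *\<^sub>R x"
    and cinner_commute: "cinner x y = cnj (cinner y x)"
    and cinner_add_left: "cinner (x + y) z = cinner x z + cinner y z"
    and cinner_scaleC_left: "cinner (a *\<^sub>C x) y = a * cinner x y"
    and inner_eq_Re_cinner: "inner x y = Re (cinner x y)"

class chilbert_space = complex_inner + complete_space

lemma cinner_self_eq_norm: "cinner x x = complex_of_real ((norm x)\<^sup>2)"
  for x :: "'a::complex_inner"
proof -
  have "Im (cinner x x) = 0"
    using arg_cong[OF cinner_commute[of x x], of Im] by simp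
  moreover have "Re (cinner x x) = (norm x)\<^sup>2"
    by (simp add: inner_eq_Re_cinner[symmetric] power2_norm_eq_inner)
  ultimately show ?thesis
    by (simp add: complex_eq_iff)
qed

global_interpretation complex_vector: vector_space "scaleC :: complex \<Rightarrow> 'a \<Rightarrow> 'a::complex_inner"
proof
  show "1 *\<^sub>C x = x" for x :: 'a
    using scaleC_of_real[of 1 x] by simp
qed (simp_all add: scaleC_add_right scaleC_add_left scaleC_scaleC)

instantiation complex :: chilbert_space
begin
definition scaleC_complex :: "complex \<Rightarrow> complex \<Rightarrow> complex" where "scaleC_complex a x = a * x"
definition cinner_complex :: "complex \<Rightarrow> complex \<Rightarrow> complex" where "cinner_complex x y = x * cnj y"
instance
  by standard
    (simp_all add: scaleC_complex_def cinner_complex_def algebra_simps inner_complex_def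
       scaleR_conv_of_real)
end

text \<open>A Hilbert space \<open>X\<close> is represented as a closed complex subspace of a type of class
  \<open>chilbert_space\<close>. An operator on \<open>X\<close> is a function on the whole type of which only the
  values on \<open>X\<close> matter; in particular adjoints are taken relative to \<open>X\<close>.\<close>

definition closed_csubspace :: "'h::complex_inner set \<Rightarrow> bool" where
  "closed_csubspace X \<longleftrightarrow> complex_vector.subspace X \<and> closed X"

definition closed_cspan :: "'h::complex_inner set \<Rightarrow> 'h set" where
  "closed_cspan A = closure (complex_vector.span A)"

definition bounded_op :: "'h::complex_inner set \<Rightarrow> 'h set \<Rightarrow> ('h \<Rightarrow> 'h) \<Rightarrow> bool" where
  "bounded_op X Y A \<longleftrightarrow> A ` X \<subseteq> Y
     \<and> (\<forall>x\<in>X. \<forall>y\<in>X. A (x + y) = A x + A y)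
     \<and> (\<forall>a. \<forall>x\<in>X. A (a *\<^sub>C x) = a *\<^sub>C A x)
     \<and> (\<exists>B. \<forall>x\<in>X. norm (A x) \<le> B * norm x)"

text \<open>If \<open>A\<close> is bounded on \<open>X\<close>, then the vector below exists (Riesz) and is unique.\<close>

definition adj :: "'h::complex_inner set \<Rightarrow> ('h \<Rightarrow> 'h) \<Rightarrow> 'h \<Rightarrow> 'h" where
  "adj X A y = (THE z. z \<in> X \<and> (\<forall>x\<in>X. cinner (A x) y = cinner x z))"

definition orthogonal_direct_sum :: "'i set \<Rightarrow> ('i \<Rightarrow> 'h::complex_inner set) \<Rightarrow> 'h set \<Rightarrow> bool" where
  "orthogonal_direct_sum I X Y \<longleftrightarrow> finite I
     \<and> (\<forall>i\<in>I. closed_csubspace (X i) \<and> X i \<subseteq> Y)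
     \<and> (\<forall>i\<in>I. \<forall>j\<in>I. i \<noteq> j \<longrightarrow> (\<forall>x\<in>X i. \<forall>y\<in>X j. cinner x y = 0))
     \<and> (\<forall>y\<in>Y. \<exists>!f. f \<in> (\<Pi>\<^sub>E i\<in>I. X i) \<and> y = (\<Sum>i\<in>I. f i))"

definition row_coisometry :: "nat \<Rightarrow> 'h::chilbert_space set \<Rightarrow> (nat \<Rightarrow> 'h \<Rightarrow> 'h) \<Rightarrow> bool" where
  "row_coisometry N K V \<longleftrightarrow> closed_csubspace K
     \<and> (\<forall>i<N. bounded_op K K (V i))
     \<and> (\<forall>x\<in>K. (\<Sum>i<N. V i (adj K (V i) x)) = x)"

definition cuntz_rep :: "nat \<Rightarrow> 'h::chilbert_space set \<Rightarrow> (nat \<Rightarrow> 'h \<Rightarrow> 'h) \<Rightarrow> bool" where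
  "cuntz_rep N X S \<longleftrightarrow> closed_csubspace X
     \<and> (\<forall>i<N. bounded_op X X (S i))
     \<and> (\<forall>x\<in>X. (\<Sum>i<N. S i (adj X (S i) x)) = x)
     \<and> (\<forall>i<N. \<forall>j<N. \<forall>x\<in>X. adj X (S j) (S i x) = (if j = i then x else 0))"

definition invariant_subspace ::
    "nat \<Rightarrow> 'h::chilbert_space set \<Rightarrow> (nat \<Rightarrow> 'h \<Rightarrow> 'h) \<Rightarrow> 'h set \<Rightarrow> bool" where
  "invariant_subspace N X S L \<longleftrightarrow> closed_csubspace L \<and> L \<subseteq> X
     \<and> (\<forall>i<N. \<forall>x\<in>L. S i x \<in> L \<and> adj X (S i) x \<in> L)"

definition irreducible_rep :: "nat \<Rightarrow> 'h::chilbert_space set \<Rightarrow> (nat \<Rightarrow> 'h \<Rightarrow> 'h) \<Rightarrow> bool" where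
  "irreducible_rep N X S \<longleftrightarrow> cuntz_rep N X S
     \<and> (\<forall>L. invariant_subspace N X S L \<longrightarrow> L = {0} \<or> L = X)"

definition disjoint_reps :: "nat \<Rightarrow> 'h::chilbert_space set \<Rightarrow> (nat \<Rightarrow> 'h \<Rightarrow> 'h)
    \<Rightarrow> 'h set \<Rightarrow> (nat \<Rightarrow> 'h \<Rightarrow> 'h) \<Rightarrow> bool" where
  "disjoint_reps N X S X' S' \<longleftrightarrow> \<not> (\<exists>W. bounded_op X X' W \<and> (\<exists>x\<in>X. W x \<noteq> 0)
     \<and> (\<forall>i<N. \<forall>x\<in>X. W (S i x) = S' i (W x) \<and> W (adj X (S i) x) = adj X' (S' i) (W x)))"

text \<open>The orbit of \<open>A\<close> under all products of the operators \<open>S i\<close> and their adjoints, so that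
  its linear span is the image of \<open>A\<close> under the *-algebra generated by the \<open>S i\<close>.\<close>

inductive_set star_orbit ::
    "nat \<Rightarrow> 'h::chilbert_space set \<Rightarrow> (nat \<Rightarrow> 'h \<Rightarrow> 'h) \<Rightarrow> 'h set \<Rightarrow> 'h set"
  for N X S A where
    base: "x \<in> A \<Longrightarrow> x \<in> star_orbit N X S A"
  | op: "x \<in> star_orbit N X S A \<Longrightarrow> i < N \<Longrightarrow> S i x \<in> star_orbit N X S A"
  | op_adj: "x \<in> star_orbit N X S A \<Longrightarrow> i < N \<Longrightarrow> adj X (S i) x \<in> star_orbit N X S A"

definition cyclic :: "nat \<Rightarrow> 'h::chilbert_space set \<Rightarrow> (nat \<Rightarrow> 'h \<Rightarrow> 'h) \<Rightarrow> 'h set \<Rightarrow> bool" where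
  "cyclic N X S A \<longleftrightarrow> A \<subseteq> X \<and> closed_cspan (star_orbit N X S A) = X"

definition cuntz_dilation :: "nat \<Rightarrow> 'h::chilbert_space set \<Rightarrow> (nat \<Rightarrow> 'h \<Rightarrow> 'h)
    \<Rightarrow> 'h set \<Rightarrow> (nat \<Rightarrow> 'h \<Rightarrow> 'h) \<Rightarrow> bool" where
  "cuntz_dilation N K V H S \<longleftrightarrow> cuntz_rep N H S \<and> K \<subseteq> H \<and> cyclic N H S K
     \<and> (\<forall>i<N. \<forall>x\<in>K. adj H (S i) x \<in> K \<and> adj K (V i) x = adj H (S i) x)"

definition contraction :: "('t::metric_space \<Rightarrow> 't) \<Rightarrow> bool" where
  "contraction f \<longleftrightarrow> (\<exists>c. 0 < c \<and> c < 1 \<and> (\<forall>x y. dist (f x) (f y) \<le> c * dist x y))"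

definition invariant_set ::
    "nat \<Rightarrow> (nat \<Rightarrow> 't \<Rightarrow> complex) \<Rightarrow> (nat \<Rightarrow> 't \<Rightarrow> 't) \<Rightarrow> 't set \<Rightarrow> bool" where
  "invariant_set N \<nu> g M \<longleftrightarrow> (\<forall>t\<in>M. \<forall>i<N. \<nu> i t \<noteq> 0 \<longrightarrow> g i t \<in> M)"

definition minimal_set :: "nat \<Rightarrow> (nat \<Rightarrow> 't::topological_space \<Rightarrow> complex)
    \<Rightarrow> (nat \<Rightarrow> 't \<Rightarrow> 't) \<Rightarrow> 't set \<Rightarrow> bool" where
  "minimal_set N \<nu> g M \<longleftrightarrow> M \<noteq> {} \<and> closed M \<and> invariant_set N \<nu> g M
     \<and> \<not> (\<exists>M'. M' \<noteq> {} \<and> M' \<subset> M \<and> closed M' \<and> invariant_set N \<nu> g M')"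

definition minimal_compact_invariant_sets :: "nat \<Rightarrow> (nat \<Rightarrow> 't::topological_space \<Rightarrow> complex)
    \<Rightarrow> (nat \<Rightarrow> 't \<Rightarrow> 't) \<Rightarrow> 't set set" where
  "minimal_compact_invariant_sets N \<nu> g = {M. compact M \<and> invariant_set N \<nu> g M \<and> minimal_set N \<nu> g M}"

definition word_op :: "(nat \<Rightarrow> 'h \<Rightarrow> 'h) \<Rightarrow> nat list \<Rightarrow> 'h \<Rightarrow> 'h" where
  "word_op S \<omega> = foldr (\<lambda>i A. S i \<circ> A) \<omega> id"

definition K_space :: "('t \<Rightarrow> 'h::complex_inner) \<Rightarrow> 't set \<Rightarrow> 'h set" where
  "K_space e M = closed_cspan (e ` M)"

definition H_space ::
    "nat \<Rightarrow> (nat \<Rightarrow> 'h \<Rightarrow> 'h) \<Rightarrow> ('t \<Rightarrow> 'h::complex_inner) \<Rightarrow> 't set \<Rightarrow> 'h set" where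
  "H_space N S e M = closed_cspan {word_op S \<omega> (e t) |t \<omega>. t \<in> M \<and> \<omega> \<in> lists {..<N}}"

end

theory Submission
  imports Defs
begin

text \<open>If \<open>W\<close> commutes with all \<open>S\<^sub>i\<close> and \<open>S\<^sub>i\<^sup>*\<close>, its kernel \<open>F(s,t) = \<langle>W e\<^sub>s, e\<^sub>t\<rangle>\<close> satisfies
  \<open>F(s,t) = \<Sum>\<^sub>i \<nu>\<^sub>i(s) cnj(\<nu>\<^sub>i(t)) F(g\<^sub>i(s), g\<^sub>i(t))\<close>, where \<open>\<Sum>\<^sub>i |\<nu>\<^sub>i(t)|\<^sup>2 = 1\<close>. Iterating moves the
  arguments together, so \<open>F\<close> vanishes as soon as it is uniformly small near the diagonal. Over two
  distinct minimal sets this is vacuously so, because they have positive distance: this gives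
  orthogonality (\<open>W = I\<close>) and disjointness. On the diagonal, for the projection \<open>W = P\<close> onto an
  invariant subspace, \<open>F(t,t)\<close> is harmonic, and the set where it attains its maximum over a compact
  invariant set is invariant. So \<open>F(t,t)\<close> is a constant \<open>m\<close> on a minimal set, the kernel of
  \<open>P - m\<close> vanishes, and \<open>P\<close> is scalar, which is irreducibility. If \<open>P\<close> projects onto the complement
  of all \<open>H(M)\<close>, the maximum over an orbit closure, which is compact, is attained on a minimal set,
  where \<open>F(t,t) = 0\<close>; hence \<open>P = 0\<close> by cyclicity. Finally, all minimal sets lie in one compact
  orbit closure and yield orthonormal vectors \<open>e\<^sub>t\<close>, so there are finitely many.\<close>

section \<open>Complex inner product spaces\<close>

lemma cinner_add_right: "cinner x (y + z) = cinner x y + cinner x z"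
  by (metis cinner_add_left cinner_commute complex_cnj_add)

lemma cinner_scaleC_right: "cinner x (a *\<^sub>C y) = cnj a * cinner x y"
  by (metis cinner_commute cinner_scaleC_left complex_cnj_mult)

lemma norm_scaleC: "norm (a *\<^sub>C x) = cmod a * norm x"
  for x :: "'a::complex_inner"
proof -
  have "complex_of_real ((norm (a *\<^sub>C x))\<^sup>2) = a * cnj a * complex_of_real ((norm x)\<^sup>2)"
    by (simp only: cinner_self_eq_norm [symmetric] cinner_scaleC_left cinner_scaleC_right ac_simps)
  also have "\<dots> = complex_of_real ((cmod a * norm x)\<^sup>2)"
    by (simp add: complex_norm_square [symmetric] power_mult_distrib)
  finally have "(norm (a *\<^sub>C x))\<^sup>2 = (cmod a * norm x)\<^sup>2"
    by (simp only: of_real_eq_iff)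
  then show ?thesis
    by (simp add: power2_eq_iff_nonneg)
qed

lemma norm_cinner_le: "cmod (cinner x y) \<le> norm x * norm y"
proof (cases "cinner x y = 0")
  case False
  \<comment> \<open>A phase of modulus one that turns \<open>cinner x y\<close> into its modulus, so
    that the real Cauchy-Schwarz inequality applies.\<close>
  define a where "a = cnj (cinner x y) / cmod (cinner x y)"
  have "cmod (cinner x y) = Re (a * cinner x y)"
  proof -
    have "a * cinner x y = (cinner x y * cnj (cinner x y)) / cmod (cinner x y)"
      by (simp add: a_def)
    also have "\<dots> = complex_of_real (cmod (cinner x y))"
      using False by (simp only: complex_norm_square [symmetric]) (simp add: power2_eq_square)
    finally show ?thesis by simp
  qed
  also have "\<dots> = inner (a *\<^sub>C x) y"
    by (simp add: inner_eq_Re_cinner cinner_scaleC_left)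
  also have "\<dots> \<le> norm (a *\<^sub>C x) * norm y"
    by (rule norm_cauchy_schwarz)
  also have "\<dots> = norm x * norm y"
    using False by (simp add: norm_scaleC a_def norm_divide)
  finally show ?thesis .
qed simp

lemma scaleR_eq_scaleC: "r *\<^sub>R x = complex_of_real r *\<^sub>C x"
  by (simp add: scaleC_of_real)

global_interpretation scaleC: bounded_bilinear "scaleC :: complex \<Rightarrow> 'a \<Rightarrow> 'a::complex_inner"
proof
  show "\<exists>K. \<forall>a (x::'a). norm (a *\<^sub>C x) \<le> norm a * norm x * K"
    by (rule exI [of _ 1]) (simp add: norm_scaleC)
  show "(r *\<^sub>R a) *\<^sub>C x = r *\<^sub>R (a *\<^sub>C x)" for r a and x :: 'a
    by (simp add: scaleR_conv_of_real scaleR_eq_scaleC [of r "a *\<^sub>C x"] scaleC_scaleC)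
  show "a *\<^sub>C r *\<^sub>R x = r *\<^sub>R (a *\<^sub>C x)" for r a and x :: 'a
    by (simp only: scaleR_eq_scaleC scaleC_scaleC mult.commute)
qed (simp_all add: scaleC_add_left scaleC_add_right)

text \<open>Conjugate linearity in the second argument is still linearity over the reals, so limits,
  continuity, differences and sums come from \<open>bounded_bilinear\<close>.\<close>

global_interpretation cinner: bounded_bilinear "cinner :: 'a \<Rightarrow> 'a::complex_inner \<Rightarrow> complex"
proof
  show "\<exists>K. \<forall>x y::'a. norm (cinner x y) \<le> norm x * norm y * K"
    by (rule exI [of _ 1]) (simp add: norm_cinner_le)
  show "cinner (r *\<^sub>R x) y = r *\<^sub>R cinner x y" "cinner x (r *\<^sub>R y) = r *\<^sub>R cinner x y" for r and x y :: 'a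
    by (simp_all add: scaleR_eq_scaleC [of r x] scaleR_eq_scaleC [of r y] cinner_scaleC_left
        cinner_scaleC_right scaleR_conv_of_real)
qed (simp_all add: cinner_add_left cinner_add_right)

lemma cinner_self_eq_0_iff: "cinner x x = 0 \<longleftrightarrow> x = 0"
  by (simp add: cinner_self_eq_norm)

lemma cinner_eq_0_commute: "cinner x y = 0 \<longleftrightarrow> cinner y x = 0"
  by (metis cinner_commute complex_cnj_zero_iff)

lemma cinner_eqI:
  assumes "complex_vector.subspace X" "u \<in> X" "v \<in> X" "\<And>x. x \<in> X \<Longrightarrow> cinner x u = cinner x v"
  shows "u = v"
proof -
  have "u - v \<in> X" using assms by (simp add: complex_vector.subspace_diff)
  then have "cinner (u - v) (u - v) = 0"
    using assms(4) by (simp add: cinner.diff_right)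
  then show ?thesis by (simp add: cinner_self_eq_0_iff)
qed

section \<open>Closed subspaces and projections\<close>

lemma closed_csubspaceD:
  assumes "closed_csubspace X"
  shows "complex_vector.subspace X" "closed X"
  using assms by (auto simp: closed_csubspace_def)

lemma closed_csubspace_closed_cspan: "closed_csubspace (closed_cspan A)"
proof -
  let ?S = "complex_vector.span A"
  have S: "complex_vector.subspace ?S" by simp
  have "complex_vector.subspace (closure ?S)"
  proof (rule complex_vector.subspaceI)
    show "0 \<in> closure ?S"
      using S closure_subset complex_vector.subspace_0 by blast
  next
    fix x y assume "x \<in> closure ?S" "y \<in> closure ?S"
    then obtain f h where f: "\<And>n. f n \<in> ?S" "f \<longlonglongrightarrow> x" and h: "\<And>n. h n \<in> ?S" "h \<longlonglongrightarrow> y"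
      unfolding closure_sequential by auto
    then have "\<And>n. f n + h n \<in> ?S" "(\<lambda>n. f n + h n) \<longlonglongrightarrow> x + y"
      by (auto intro: complex_vector.span_add tendsto_add)
    then show "x + y \<in> closure ?S"
      unfolding closure_sequential by (intro exI [of _ "\<lambda>n. f n + h n"]) auto
  next
    fix a x assume "x \<in> closure ?S"
    then obtain f where f: "\<And>n. f n \<in> ?S" "f \<longlonglongrightarrow> x"
      unfolding closure_sequential by auto
    then have "\<And>n. a *\<^sub>C f n \<in> ?S" "(\<lambda>n. a *\<^sub>C f n) \<longlonglongrightarrow> a *\<^sub>C x"
      by (auto intro: complex_vector.span_scale scaleC.tendsto)
    then show "a *\<^sub>C x \<in> closure ?S"
      unfolding closure_sequential by (intro exI [of _ "\<lambda>n. a *\<^sub>C f n"]) auto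
  qed
  then show ?thesis by (simp add: closed_csubspace_def closed_cspan_def)
qed

lemma closed_cspan_superset: "A \<subseteq> closed_cspan A"
  unfolding closed_cspan_def using closure_subset complex_vector.span_superset by blast

lemma closed_cspan_minimal:
  assumes "closed_csubspace D" "A \<subseteq> D"
  shows "closed_cspan A \<subseteq> D"
  unfolding closed_cspan_def
  using assms by (intro closure_minimal complex_vector.span_minimal) (auto simp: closed_csubspace_def)

text \<open>A minimising sequence is Cauchy by the parallelogram law: the midpoint of two almost
  closest points lies in \<open>L\<close>, hence is at distance at least \<open>d\<close> from
  \<open>x\<close>, and this forces the two points together.\<close>

lemma closest_point_closed_csubspace:
  fixes L :: "'h::chilbert_space set"
  assumes "closed_csubspace L"
  obtains z where "z \<in> L" "\<And>y. y \<in> L \<Longrightarrow> dist x z \<le> dist x y"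
proof -
  have sub: "complex_vector.subspace L" and cl: "closed L"
    using assms by (auto simp: closed_csubspace_def)
  have ne: "L \<noteq> {}" using complex_vector.subspace_0 [OF sub] by auto
  define d where "d = infdist x L"
  have d: "d \<le> dist x y" if "y \<in> L" for y
    unfolding d_def using that by (rule infdist_le)
  have d0: "0 \<le> d" by (simp add: d_def infdist_nonneg)
  have "\<exists>y\<in>L. dist x y < d + 1 / Suc n" for n
    using cInf_lessD [of "dist x ` L" "d + 1 / Suc n"] ne by (auto simp: d_def infdist_notempty)
  then obtain f where f: "\<And>n. f n \<in> L" "\<And>n. dist x (f n) < d + 1 / Suc n"
    by metis
  \<comment> \<open>The parallelogram law yields this bound: twice \<open>(d + 1 / Suc n)^2\<close>
    from each of the two points, minus \<open>(2 * d)^2\<close> from their midpoint.\<close>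
  define b where "b n = 4 * ((d + 1 / real (Suc n))\<^sup>2 - d\<^sup>2)" for n
  have b: "b \<longlonglongrightarrow> 0"
  proof -
    have "b \<longlonglongrightarrow> 4 * ((d + 0)\<^sup>2 - d\<^sup>2)"
      unfolding b_def
      by (intro tendsto_intros LIMSEQ_inverse_real_of_nat[unfolded inverse_eq_divide])
    then show ?thesis by simp
  qed
  have close: "(dist (f m) (f n))\<^sup>2 \<le> b k" if "k \<le> m" "k \<le> n" for m n k
  proof -
    let ?u = "x - f m" and ?v = "x - f n"
    have le: "norm (x - f j) \<le> d + 1 / Suc k" if "k \<le> j" for j
    proof -
      have "1 / real (Suc j) \<le> 1 / Suc k" using that by (simp add: frac_le)
      then show ?thesis using f(2) [of j] by (simp add: dist_norm)
    qed
    have mid: "(1/2) *\<^sub>R (f m + f n) \<in> L"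
      using sub f(1) by (auto simp: scaleR_eq_scaleC intro!: complex_vector.subspace_add complex_vector.subspace_scale)
    have "d \<le> norm (x - (1/2) *\<^sub>R (f m + f n))"
      using d [OF mid] by (simp add: dist_norm)
    also have "x - (1/2) *\<^sub>R (f m + f n) = (1/2) *\<^sub>R (?u + ?v)"
    proof -
      have "x = (1/2) *\<^sub>R x + (1/2) *\<^sub>R x" by (simp flip: scaleR_add_left)
      then show ?thesis by (simp add: algebra_simps)
    qed
    finally have "2 * d \<le> norm (?u + ?v)" by simp
    then have "(2 * d)\<^sup>2 \<le> (norm (?u + ?v))\<^sup>2" using d0 by (intro power_mono) auto
    moreover have "(norm (?u + ?v))\<^sup>2 + (norm (?u - ?v))\<^sup>2 = 2 * (norm ?u)\<^sup>2 + 2 * (norm ?v)\<^sup>2"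
      by (simp add: power2_norm_eq_inner inner_add_left inner_add_right inner_diff_left inner_diff_right inner_commute)
    moreover have "(norm ?u)\<^sup>2 \<le> (d + 1 / Suc k)\<^sup>2" "(norm ?v)\<^sup>2 \<le> (d + 1 / Suc k)\<^sup>2"
      using le that by (auto intro!: power_mono)
    moreover have "(norm (?u - ?v))\<^sup>2 = (dist (f m) (f n))\<^sup>2"
      by (simp add: dist_norm norm_minus_commute)
    ultimately show ?thesis unfolding b_def by (simp add: power_mult_distrib)
  qed
  have "Cauchy f"
  proof (rule metric_CauchyI)
    fix \<epsilon> :: real assume "0 < \<epsilon>"
    then have "\<forall>\<^sub>F k in sequentially. b k < \<epsilon>\<^sup>2"
      using b by (intro order_tendstoD) auto
    then obtain k where k: "b k < \<epsilon>\<^sup>2"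
      using eventually_happens' [OF sequentially_bot] by blast
    have "dist (f m) (f n) < \<epsilon>" if "k \<le> m" "k \<le> n" for m n
      using le_less_trans [OF close [OF that] k] \<open>0 < \<epsilon>\<close> by (simp add: power_less_imp_less_base)
    then show "\<exists>k. \<forall>m\<ge>k. \<forall>n\<ge>k. dist (f m) (f n) < \<epsilon>" by blast
  qed
  then obtain z where z: "f \<longlonglongrightarrow> z" by (auto simp: Cauchy_convergent_iff convergent_def)
  have "z \<in> L" by (rule closed_sequentially [OF cl f(1) z])
  have "(\<lambda>n. d + 1 / real (Suc n)) \<longlonglongrightarrow> d + 0"
    by (intro tendsto_intros LIMSEQ_inverse_real_of_nat[unfolded inverse_eq_divide])
  moreover have "(\<lambda>n. dist x (f n)) \<longlonglongrightarrow> dist x z"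
    using z by (intro tendsto_intros)
  ultimately have "dist x z \<le> d"
    using f(2) by (intro LIMSEQ_le [of "\<lambda>n. dist x (f n)" _ "\<lambda>n. d + 1 / real (Suc n)"])
      (auto intro: less_imp_le)
  then show ?thesis using that [OF \<open>z \<in> L\<close>] d by (meson order_trans)
qed

definition cproj :: "'h::complex_inner set \<Rightarrow> 'h \<Rightarrow> 'h" where
  "cproj L x = (SOME z. z \<in> L \<and> (\<forall>y\<in>L. cinner (x - z) y = 0))"

text \<open>The closest point works. Convexity gives a one-sided inequality for the real part;
  testing with \<open>- y\<close> makes it an equation, and testing with i times \<open>y\<close>
  adds the imaginary part.\<close>

lemma cproj_exists:
  fixes L :: "'h::chilbert_space set"
  assumes "closed_csubspace L"
  shows "\<exists>z. z \<in> L \<and> (\<forall>y\<in>L. cinner (x - z) y = 0)"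
proof -
  have sub: "complex_vector.subspace L" and cl: "closed L"
    using assms by (auto simp: closed_csubspace_def)
  obtain z where z: "z \<in> L" "\<And>y. y \<in> L \<Longrightarrow> dist x z \<le> dist x y"
    using closest_point_closed_csubspace [OF assms] by blast
  have cv: "convex L"
    using sub by (auto simp: convex_def scaleR_eq_scaleC complex_vector.subspace_add complex_vector.subspace_scale)
  have le: "inner (x - z) y \<le> 0" if "y \<in> L" for y
    using any_closest_point_dot [OF cv cl z(1), of "z + y" x] z that sub
    by (simp add: complex_vector.subspace_add)
  have Re: "Re (cinner (x - z) y) = 0" if "y \<in> L" for y
    using le [OF that] le [of "- y"] that sub
    by (simp add: complex_vector.subspace_neg inner_eq_Re_cinner [symmetric])
  have "cinner (x - z) y = 0" if "y \<in> L" for y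
    using Re [OF that] Re [of "\<i> *\<^sub>C y"] that sub
    by (simp add: complex_vector.subspace_scale cinner_scaleC_right complex_eq_iff)
  with z(1) show ?thesis by blast
qed

lemma
  fixes L :: "'h::chilbert_space set"
  assumes "closed_csubspace L"
  shows cproj_in: "cproj L x \<in> L"
    and cinner_diff_cproj: "y \<in> L \<Longrightarrow> cinner (x - cproj L x) y = 0"
  using someI_ex [OF cproj_exists [OF assms]] unfolding cproj_def by blast+

lemma cproj_eqI:
  fixes L :: "'h::chilbert_space set"
  assumes L: "closed_csubspace L" and z: "z \<in> L" "\<And>y. y \<in> L \<Longrightarrow> cinner (x - z) y = 0"
  shows "cproj L x = z"
proof (rule cinner_eqI)
  show "complex_vector.subspace L" using L by (rule closed_csubspaceD)
  show "cproj L x \<in> L" using L by (rule cproj_in)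
  show "z \<in> L" by fact
  fix y assume y: "y \<in> L"
  have "cinner (x - z) y - cinner (x - cproj L x) y = 0"
    using z(2) [OF y] cinner_diff_cproj [OF L y] by simp
  then have "cinner (cproj L x) y = cinner z y"
    by (simp add: cinner.diff_left)
  then show "cinner y (cproj L x) = cinner y z"
    by (metis cinner_commute)
qed

lemma cproj_ident:
  fixes L :: "'h::chilbert_space set"
  assumes "closed_csubspace L" "x \<in> L"
  shows "cproj L x = x"
  using assms by (intro cproj_eqI) (auto simp: cinner.zero_left)

text \<open>The residual is orthogonal to the projection. For \<open>x = e t\<close> this shows that
  the diagonal of the kernel of a projection is real, which gives access to a maximum
  principle.\<close>

lemma cinner_cproj:
  fixes L :: "'h::chilbert_space set"
  assumes "closed_csubspace L"
  shows "cinner (cproj L x) x = complex_of_real ((norm (cproj L x))\<^sup>2)"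
proof -
  have "cinner (cproj L x) (x - cproj L x) = 0"
    using cinner_diff_cproj [OF assms cproj_in [OF assms]] cinner_eq_0_commute by blast
  then show ?thesis by (simp add: cinner.diff_right cinner_self_eq_norm)
qed

lemma norm_cproj_le:
  fixes L :: "'h::chilbert_space set"
  assumes "closed_csubspace L"
  shows "norm (cproj L x) \<le> norm x"
proof -
  have "(norm (cproj L x))\<^sup>2 \<le> norm (cproj L x) * norm x"
    using norm_cinner_le [of "cproj L x" x]
    by (simp only: cinner_cproj [OF assms] norm_of_real abs_power2)
  then show ?thesis
    by (cases "cproj L x = 0") (auto simp: power2_eq_square)
qed

lemma bounded_op_cproj:
  fixes L :: "'h::chilbert_space set"
  assumes "closed_csubspace L" "L \<subseteq> Y"
  shows "bounded_op X Y (cproj L)"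
proof -
  note sub = closed_csubspaceD(1) [OF assms(1)]
  have "cproj L (x + y) = cproj L x + cproj L y" for x y
    using sub cproj_in [OF assms(1)] cinner_diff_cproj [OF assms(1)]
    by (intro cproj_eqI [OF assms(1)])
      (auto simp: complex_vector.subspace_add add_diff_add cinner.add_left)
  moreover have "cproj L (a *\<^sub>C x) = a *\<^sub>C cproj L x" for a x
    using sub cproj_in [OF assms(1)] cinner_diff_cproj [OF assms(1)]
    by (intro cproj_eqI [OF assms(1)])
      (auto simp: complex_vector.subspace_scale cinner_scaleC_left simp flip: scaleC.diff_right)
  moreover have "norm (cproj L x) \<le> 1 * norm x" for x
    using norm_cproj_le [OF assms(1)] by simp
  ultimately show ?thesis
    using cproj_in [OF assms(1)] assms(2) unfolding bounded_op_def by blast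
qed

section \<open>Bounded operators and adjoints\<close>

lemma bounded_opD:
  assumes "bounded_op X Y A"
  shows "x \<in> X \<Longrightarrow> A x \<in> Y"
    and "x \<in> X \<Longrightarrow> y \<in> X \<Longrightarrow> A (x + y) = A x + A y"
    and "x \<in> X \<Longrightarrow> A (a *\<^sub>C x) = a *\<^sub>C A x"
  using assms by (auto simp: bounded_op_def)

lemma bounded_op_0: "bounded_op X Y A \<Longrightarrow> x \<in> X \<Longrightarrow> A 0 = 0"
  using bounded_opD(3) [of X Y A x 0] by simp

lemma bounded_op_bound:
  assumes "bounded_op X Y A"
  obtains B where "B > 0" "\<And>x. x \<in> X \<Longrightarrow> norm (A x) \<le> B * norm x"
proof -
  obtain B where B: "\<And>x. x \<in> X \<Longrightarrow> norm (A x) \<le> B * norm x"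
    using assms unfolding bounded_op_def by blast
  show ?thesis
  proof (rule that)
    show "\<bar>B\<bar> + 1 > 0" by simp
    fix x assume "x \<in> X"
    have "norm (A x) \<le> B * norm x" by (rule B) fact
    also have "\<dots> \<le> (\<bar>B\<bar> + 1) * norm x" by (rule mult_right_mono) auto
    finally show "norm (A x) \<le> (\<bar>B\<bar> + 1) * norm x" .
  qed
qed

lemma bounded_op_diff:
  assumes "bounded_op X Y A" "complex_vector.subspace X" "x \<in> X" "y \<in> X"
  shows "A (x - y) = A x - A y"
proof -
  have "A (x - y) + A y = A (x - y + y)"
    using assms by (intro bounded_opD(2) [symmetric] complex_vector.subspace_diff)
  then show ?thesis by (simp add: algebra_simps)
qed

lemma bounded_op_sum:
  assumes "bounded_op X Y A" "complex_vector.subspace X" "\<And>i. i \<in> I \<Longrightarrow> f i \<in> X"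
  shows "A (\<Sum>i\<in>I. f i) = (\<Sum>i\<in>I. A (f i))"
  using assms(3)
proof (induction I rule: infinite_finite_induct)
  case (insert i I)
  then show ?case
    using assms by (simp add: bounded_opD(2) complex_vector.subspace_sum)
qed (use assms in \<open>auto intro: bounded_op_0 complex_vector.subspace_0\<close>)

lemma bounded_op_continuous:
  assumes "bounded_op X Y A" "complex_vector.subspace X"
  shows "continuous_on X A"
proof -
  obtain B where B: "B > 0" "\<And>x. x \<in> X \<Longrightarrow> norm (A x) \<le> B * norm x"
    using bounded_op_bound [OF assms(1)] by metis
  have "dist (A x) (A y) \<le> B * dist x y" if "x \<in> X" "y \<in> X" for x y
    using B(2) [of "x - y"] bounded_op_diff [OF assms that] assms(2) that
    by (simp add: complex_vector.subspace_diff dist_norm)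
  then have "B-lipschitz_on X A" using B(1) by (intro lipschitz_onI) auto
  then show ?thesis by (rule lipschitz_on_continuous_on)
qed

text \<open>Serves to prove that \<open>A\<close> maps a closed span into \<open>Y\<close>: checking
  the generators is then enough.\<close>

lemma closed_csubspace_vimage:
  assumes A: "bounded_op X Z A" and X: "closed_csubspace X" and Y: "closed_csubspace Y"
  shows "closed_csubspace {x\<in>X. A x \<in> Y}"
proof -
  note Xs = closed_csubspaceD [OF X] and Ys = closed_csubspaceD [OF Y]
  have "closed (X \<inter> A -` Y)"
    using bounded_op_continuous [OF A Xs(1)] Xs(2) Ys(2) by (simp add: continuous_on_closed_vimage Int_commute)
  moreover have "X \<inter> A -` Y = {x\<in>X. A x \<in> Y}" by auto
  moreover have "complex_vector.subspace {x\<in>X. A x \<in> Y}"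
    using Xs(1) Ys(1) bounded_opD [OF A] bounded_op_0 [OF A complex_vector.subspace_0 [OF Xs(1)]]
    by (auto simp: complex_vector.subspace_def)
  ultimately show ?thesis by (simp add: closed_csubspace_def)
qed

lemma closed_csubspace_INT:
  assumes "\<And>i. i \<in> I \<Longrightarrow> closed_csubspace (X i)"
  shows "closed_csubspace (\<Inter>i\<in>I. X i)"
  using assms unfolding closed_csubspace_def
  by (auto intro!: closed_INT complex_vector.subspace_Inter)

lemma closed_csubspace_Int:
  assumes "closed_csubspace X" "closed_csubspace Y"
  shows "closed_csubspace (X \<inter> Y)"
  using assms unfolding closed_csubspace_def
  by (auto intro!: closed_Int complex_vector.subspace_inter)

lemma closed_csubspace_ortho: "closed_csubspace {x. \<forall>y\<in>A. cinner x y = 0}"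
proof -
  have "closed_csubspace (\<Inter>y\<in>A. {x. cinner x y = 0})"
  proof (rule closed_csubspace_INT)
    fix y
    have "closed {x. cinner x y = 0}"
      by (intro closed_Collect_eq continuous_intros cinner.continuous_on)
    then show "closed_csubspace {x. cinner x y = 0}"
      by (auto simp: closed_csubspace_def complex_vector.subspace_def cinner.add_left
          cinner_scaleC_left cinner.zero_left)
  qed
  then show ?thesis by (simp add: INTER_eq)
qed

text \<open>Riesz: the vector is found in the orthogonal complement of the kernel.\<close>

lemma cinner_representation:
  fixes X :: "'h::chilbert_space set"
  assumes X: "closed_csubspace X" and A: "bounded_op X UNIV A"
  shows "\<exists>z\<in>X. \<forall>x\<in>X. cinner (A x) y = cinner x z"
proof (cases "\<forall>x\<in>X. cinner (A x) y = 0")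
  case True
  then show ?thesis
    using closed_csubspaceD(1) [OF X] by (auto intro!: bexI [of _ 0] simp: cinner.zero_right complex_vector.subspace_0)
next
  case False
  then obtain u where u: "u \<in> X" "cinner (A u) y \<noteq> 0" by blast
  note Xs = closed_csubspaceD(1) [OF X]
  define L where "L = {x\<in>X. A x \<in> {x. \<forall>y\<in>{y}. cinner x y = 0}}"
  have L: "closed_csubspace L"
    unfolding L_def by (rule closed_csubspace_vimage [OF A X closed_csubspace_ortho])
  have PL: "cproj L u \<in> X" "cinner (A (cproj L u)) y = 0"
    using cproj_in [OF L, of u] by (auto simp: L_def)
  define v where "v = u - cproj L u"
  have v: "v \<in> X" using u PL Xs by (simp add: v_def complex_vector.subspace_diff)
  have Av: "cinner (A v) y = cinner (A u) y"
    using bounded_op_diff [OF A Xs u(1) PL(1)] PL(2) by (simp add: v_def cinner.diff_left)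
  have "v \<noteq> 0" using Av u(2) bounded_op_0 [OF A v] by (auto simp: cinner.zero_left)
  define a where "a = cinner (A v) y / cinner v v"
  have "cinner (A x) y = cinner x (cnj a *\<^sub>C v)" if x: "x \<in> X" for x
  proof -
    \<comment> \<open>The combination of \<open>x\<close> and \<open>v\<close> that the functional
      annihilates. Being in \<open>L\<close> it is orthogonal to \<open>v\<close>, and this
      determines \<open>cinner (A x) y\<close>.\<close>
    define w where "w = cinner (A v) y *\<^sub>C x - cinner (A x) y *\<^sub>C v"
    have "w \<in> X" using x v Xs by (simp add: w_def complex_vector.subspace_diff complex_vector.subspace_scale)
    moreover have "cinner (A w) y = 0"
      using x v Xs unfolding w_def
      by (subst bounded_op_diff [OF A Xs])
        (simp_all add: bounded_opD(3) [OF A] complex_vector.subspace_scale cinner.diff_left cinner_scaleC_left)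
    ultimately have "w \<in> L" by (simp add: L_def)
    then have "cinner w v = 0"
      using cinner_diff_cproj [OF L] unfolding v_def by (subst cinner_eq_0_commute)
    then have "cinner (A v) y * cinner x v = cinner (A x) y * cinner v v"
      by (simp add: w_def cinner.diff_left cinner_scaleC_left)
    then show ?thesis
      using \<open>v \<noteq> 0\<close> by (simp add: a_def cinner_scaleC_right cinner_self_eq_0_iff field_simps)
  qed
  moreover have "cnj a *\<^sub>C v \<in> X" using v Xs by (simp add: complex_vector.subspace_scale)
  ultimately show ?thesis by blast
qed

section \<open>Adjoints relative to a closed subspace\<close>

lemma adj_eqI:
  assumes "complex_vector.subspace X" "z \<in> X" "\<And>x. x \<in> X \<Longrightarrow> cinner (A x) y = cinner x z"
  shows "adj X A y = z"
  unfolding adj_def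
proof (rule the_equality)
  show "z \<in> X \<and> (\<forall>x\<in>X. cinner (A x) y = cinner x z)" using assms by simp
  show "w = z" if "w \<in> X \<and> (\<forall>x\<in>X. cinner (A x) y = cinner x w)" for w
    using that assms by (intro cinner_eqI [of X]) auto
qed

text \<open>Riesz applies for every \<open>y\<close> of the type. Outside \<open>X\<close> the
  adjoint takes the value that it has at the projection of \<open>y\<close> onto
  \<open>X\<close>.\<close>

lemma
  fixes X :: "'h::chilbert_space set"
  assumes X: "closed_csubspace X" and A: "bounded_op X X A"
  shows adj_in: "adj X A y \<in> X"
    and cinner_adj: "x \<in> X \<Longrightarrow> cinner (A x) y = cinner x (adj X A y)"
proof -
  have A': "bounded_op X UNIV A" using A by (simp add: bounded_op_def)
  obtain z where z: "z \<in> X" "\<And>x. x \<in> X \<Longrightarrow> cinner (A x) y = cinner x z"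
    using cinner_representation [OF X A', of y] by blast
  have "adj X A y = z"
    using z by (rule adj_eqI [OF closed_csubspaceD(1) [OF X]])
  with z show "adj X A y \<in> X" "x \<in> X \<Longrightarrow> cinner (A x) y = cinner x (adj X A y)" by simp_all
qed

lemma bounded_op_adj:
  fixes X :: "'h::chilbert_space set"
  assumes X: "closed_csubspace X" and A: "bounded_op X X A"
  shows "bounded_op X X (adj X A)"
proof -
  obtain B where "B > 0" and B: "\<And>x. x \<in> X \<Longrightarrow> norm (A x) \<le> B * norm x"
    using bounded_op_bound [OF A] by metis
  note Xs = closed_csubspaceD(1) [OF X] and adj = adj_in [OF X A] cinner_adj [OF X A]
  have "adj X A (x + y) = adj X A x + adj X A y" for x y
    using adj by (intro adj_eqI [OF Xs]) (auto simp: cinner.add_right complex_vector.subspace_add [OF Xs])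
  moreover have "adj X A (a *\<^sub>C x) = a *\<^sub>C adj X A x" for a x
    using adj by (intro adj_eqI [OF Xs]) (auto simp: cinner_scaleC_right complex_vector.subspace_scale [OF Xs])
  moreover have "norm (adj X A x) \<le> B * norm x" for x
  proof (cases "adj X A x = 0")
    case True
    then show ?thesis using \<open>B > 0\<close> by simp
  next
    case False
    have "(norm (adj X A x))\<^sup>2 = cmod (cinner (A (adj X A x)) x)"
      by (simp add: adj cinner_self_eq_norm norm_power)
    also have "\<dots> \<le> norm (A (adj X A x)) * norm x" by (rule norm_cinner_le)
    also have "\<dots> \<le> B * norm (adj X A x) * norm x"
      using B adj(1) by (simp add: mult_right_mono)
    finally have "norm (adj X A x) * norm (adj X A x) \<le> norm (adj X A x) * (B * norm x)"
      by (simp add: power2_eq_square algebra_simps)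
    then show ?thesis using False by simp
  qed
  ultimately show ?thesis
    using adj(1) unfolding bounded_op_def by (intro conjI exI [of _ B]) auto
qed


section \<open>Representations of the Cuntz algebra\<close>

locale cuntz_representation =
  fixes N :: nat and H :: "'h::chilbert_space set" and S :: "nat \<Rightarrow> 'h \<Rightarrow> 'h"
  assumes rep: "cuntz_rep N H S"
begin

abbreviation T :: "nat \<Rightarrow> 'h \<Rightarrow> 'h" where "T i \<equiv> adj H (S i)"

lemma closed_csubspace_H: "closed_csubspace H"
  using rep by (simp add: cuntz_rep_def)

lemmas subspace_H = closed_csubspaceD(1) [OF closed_csubspace_H]

lemma bounded_op_S: "i < N \<Longrightarrow> bounded_op H H (S i)"
  using rep by (simp add: cuntz_rep_def)

lemma bounded_op_T: "i < N \<Longrightarrow> bounded_op H H (T i)"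
  by (intro bounded_op_adj closed_csubspace_H bounded_op_S)

lemma T_in: "i < N \<Longrightarrow> T i x \<in> H"
  by (rule adj_in [OF closed_csubspace_H bounded_op_S])

lemma cinner_S: "i < N \<Longrightarrow> x \<in> H \<Longrightarrow> cinner (S i x) y = cinner x (T i y)"
  by (rule cinner_adj [OF closed_csubspace_H bounded_op_S])

lemma cinner_T: "i < N \<Longrightarrow> y \<in> H \<Longrightarrow> cinner (T i x) y = cinner x (S i y)"
  using cinner_S [of i y x] by (metis cinner_commute)

lemma sum_S_T: "x \<in> H \<Longrightarrow> (\<Sum>i<N. S i (T i x)) = x"
  using rep by (simp add: cuntz_rep_def)

lemma T_S: "i < N \<Longrightarrow> j < N \<Longrightarrow> x \<in> H \<Longrightarrow> T j (S i x) = (if j = i then x else 0)"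
  using rep unfolding cuntz_rep_def by blast

lemma invariant_subspaceD:
  assumes "invariant_subspace N H S L"
  shows "closed_csubspace L" "complex_vector.subspace L" "L \<subseteq> H"
    and "i < N \<Longrightarrow> x \<in> L \<Longrightarrow> S i x \<in> L" "i < N \<Longrightarrow> x \<in> L \<Longrightarrow> T i x \<in> L"
  using assms by (auto simp: invariant_subspace_def closed_csubspace_def)

lemma invariant_subspace_H: "invariant_subspace N H S H"
  using closed_csubspace_H bounded_opD(1) [OF bounded_op_S] T_in
  by (auto simp: invariant_subspace_def)

text \<open>As \<open>T i\<close> maps \<open>L\<close> into itself, \<open>T i x\<close> already
  satisfies the defining identity of the adjoint relative to \<open>L\<close>. Statements about
  sub-representations can thus be read with the adjoints in \<open>H\<close>.\<close>

lemma adj_invariant_subspace: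
  assumes L: "invariant_subspace N H S L" and "i < N" "x \<in> L"
  shows "adj L (S i) x = T i x"
  using assms invariant_subspaceD [OF L] cinner_S by (intro adj_eqI) auto

lemma cuntz_rep_invariant_subspace:
  assumes L: "invariant_subspace N H S L"
  shows "cuntz_rep N L S"
proof -
  note LD = invariant_subspaceD [OF L]
  have "bounded_op L L (S i)" if "i < N" for i
    using bounded_op_S [OF that] LD(3,4) that unfolding bounded_op_def
    by (intro conjI) (blast, blast, blast, meson subsetD)
  moreover have "(\<Sum>i<N. S i (adj L (S i) x)) = x" if "x \<in> L" for x
    using that LD(3) sum_S_T by (simp add: adj_invariant_subspace [OF L] subset_iff)
  moreover have "adj L (S j) (S i x) = (if j = i then x else 0)" if "i < N" "j < N" "x \<in> L" for i j x
    using that LD(3,4) T_S by (simp add: adj_invariant_subspace [OF L] subset_iff)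
  ultimately show ?thesis using LD(1) unfolding cuntz_rep_def by blast
qed

lemma invariant_subspace_trans:
  assumes L: "invariant_subspace N H S L" and L': "invariant_subspace N L S L'"
  shows "invariant_subspace N H S L'"
  using L' invariant_subspaceD(3) [OF L] adj_invariant_subspace [OF L]
  unfolding invariant_subspace_def by (metis subset_iff)

text \<open>In the inner product \<open>S i\<close> on the left becomes \<open>T i\<close> on the
  right and conversely, so stability of \<open>A\<close> under both families passes to its
  orthogonal complement.\<close>

lemma invariant_subspace_ortho:
  assumes "A \<subseteq> H" "\<And>i y. i < N \<Longrightarrow> y \<in> A \<Longrightarrow> S i y \<in> A" "\<And>i y. i < N \<Longrightarrow> y \<in> A \<Longrightarrow> T i y \<in> A"
  shows "invariant_subspace N H S {x\<in>H. \<forall>y\<in>A. cinner x y = 0}"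
proof -
  have "closed_csubspace (H \<inter> {x. \<forall>y\<in>A. cinner x y = 0})"
    by (intro closed_csubspace_Int closed_csubspace_H closed_csubspace_ortho)
  moreover have "H \<inter> {x. \<forall>y\<in>A. cinner x y = 0} = {x\<in>H. \<forall>y\<in>A. cinner x y = 0}" by auto
  ultimately show ?thesis
    using assms bounded_opD(1) [OF bounded_op_S]
    by (auto simp: invariant_subspace_def cinner_S cinner_T T_in subset_iff)
qed

text \<open>\<open>L\<close> is reducing: \<open>S i\<close> and \<open>T i\<close> keep
  \<open>cproj L x\<close> in \<open>L\<close> and, through their adjoints, keep the residual
  \<open>x - cproj L x\<close> orthogonal to \<open>L\<close>.\<close>

lemma cproj_commute:
  assumes L: "invariant_subspace N H S L" and i: "i < N" and x: "x \<in> H"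
  shows "cproj L (S i x) = S i (cproj L x)" "cproj L (T i x) = T i (cproj L x)"
proof -
  note LD = invariant_subspaceD [OF L]
  have P: "cproj L x \<in> L" "cproj L x \<in> H" using cproj_in [OF LD(1)] LD(3) by auto
  then have xP: "x - cproj L x \<in> H" using x by (simp add: complex_vector.subspace_diff [OF subspace_H])
  note ortho = cinner_diff_cproj [OF LD(1), of _ x]
  have "cinner (S i x - S i (cproj L x)) y = 0" if "y \<in> L" for y
    using that i x P xP LD(5) ortho
    by (simp flip: bounded_op_diff [OF bounded_op_S subspace_H] add: cinner_S)
  then show "cproj L (S i x) = S i (cproj L x)"
    using LD(4) i P by (intro cproj_eqI [OF LD(1)]) auto
  have "cinner (T i x - T i (cproj L x)) y = 0" if "y \<in> L" for y
    using that i x P xP LD(3,4) ortho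
    by (simp flip: bounded_op_diff [OF bounded_op_T subspace_H] add: cinner_T subset_iff)
  then show "cproj L (T i x) = T i (cproj L x)"
    using LD(5) i P by (intro cproj_eqI [OF LD(1)]) auto
qed

lemma cyclic_invariant_subspace:
  assumes "cyclic N H S A" and L: "invariant_subspace N H S L" and "A \<subseteq> L"
  shows "L = H"
proof
  note LD = invariant_subspaceD [OF L]
  show "L \<subseteq> H" by (rule LD)
  have "x \<in> L" if "x \<in> star_orbit N H S A" for x
    using that by induction (use LD \<open>A \<subseteq> L\<close> in auto)
  then have "closed_cspan (star_orbit N H S A) \<subseteq> L"
    by (intro closed_cspan_minimal LD) auto
  then show "H \<subseteq> L" using assms(1) by (simp add: cyclic_def)
qed

end

section \<open>Orbits of contractive systems\<close>

lemma contraction_uniform: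
  fixes N :: nat
  assumes "\<And>i. i < N \<Longrightarrow> contraction (g i)"
  obtains c where "0 < c" "c < 1" "\<And>i x y. i < N \<Longrightarrow> dist (g i x) (g i y) \<le> c * dist x y"
proof -
  have "\<forall>i. \<exists>c. i < N \<longrightarrow> 0 < c \<and> c < 1 \<and> (\<forall>x y. dist (g i x) (g i y) \<le> c * dist x y)"
    using assms unfolding contraction_def by blast
  then obtain C where C: "\<And>i. i < N \<Longrightarrow> 0 < C i \<and> C i < 1 \<and> (\<forall>x y. dist (g i x) (g i y) \<le> C i * dist x y)"
    by metis
  \<comment> \<open>Inserting \<open>1/2\<close> makes the set nonempty and the maximum positive
    even for \<open>N = 0\<close>.\<close>
  define c where "c = Max (insert (1/2) (C ` {..<N}))"
  have ge: "1/2 \<le> c" "\<And>i. i < N \<Longrightarrow> C i \<le> c" unfolding c_def by (rule Max_ge; simp)+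
  show ?thesis
  proof
    show "0 < c" using ge(1) by linarith
    show "c < 1" using C by (auto simp: c_def)
    fix i x y assume i: "i < N"
    have "dist (g i x) (g i y) \<le> C i * dist x y" using C i by blast
    also have "\<dots> \<le> c * dist x y" using ge(2) [OF i] by (simp add: mult_right_mono)
    finally show "dist (g i x) (g i y) \<le> c * dist x y" .
  qed
qed

text \<open>All maps are followed, also where their weight vanishes. Hence the closure is stable
  under every \<open>g i\<close>, and its points can be moved by transitions that were selected at
  some other point.\<close>

inductive_set ifs_orbit :: "nat \<Rightarrow> (nat \<Rightarrow> 't \<Rightarrow> 't) \<Rightarrow> 't \<Rightarrow> 't set" for N g x where
  base: "x \<in> ifs_orbit N g x"
| step: "y \<in> ifs_orbit N g x \<Longrightarrow> i < N \<Longrightarrow> g i y \<in> ifs_orbit N g x"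

locale uniform_contractions =
  fixes N :: nat and g :: "nat \<Rightarrow> 't::complete_space \<Rightarrow> 't" and c :: real
  assumes c_pos: "0 < c" and c_less: "c < 1"
    and contr: "\<And>i x y. i < N \<Longrightarrow> dist (g i x) (g i y) \<le> c * dist x y"
begin

lemma continuous_g: "i < N \<Longrightarrow> continuous_on A (g i)"
  using contr c_pos by (intro lipschitz_on_continuous_on [of c] lipschitz_onI) auto

lemma small_power:
  assumes "0 < \<epsilon>"
  obtains n where "c ^ n * R < \<epsilon>"
proof -
  have "(\<lambda>n. c ^ n * R) \<longlonglongrightarrow> 0 * R"
    using c_pos c_less by (intro tendsto_intros LIMSEQ_realpow_zero) auto
  then have "\<forall>\<^sub>F n in sequentially. c ^ n * R < \<epsilon>"
    using assms by (intro order_tendstoD) auto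
  then show ?thesis using that eventually_happens' [OF sequentially_bot] by blast
qed

text \<open>Total boundedness, by induction on \<open>n\<close>: the images of a finite cover under
  the maps cover everything but possibly the starting point, with radii smaller by the factor
  \<open>c\<close>.\<close>

lemma ifs_orbit_covered:
  "\<exists>R. \<forall>n. \<exists>k. finite k \<and> ifs_orbit N g x \<subseteq> (\<Union>a\<in>k. cball a (c ^ n * R))"
proof -
  define D where "D = Max (insert 0 ((\<lambda>i. dist x (g i x)) ` {..<N}))"
  have D: "0 \<le> D" "\<And>i. i < N \<Longrightarrow> dist x (g i x) \<le> D" unfolding D_def by (rule Max_ge; simp)+
  \<comment> \<open>The solution of \<open>D + c * R = R\<close>, so that the ball of radius
    \<open>R\<close> about \<open>x\<close> traps the orbit.\<close>
  define R where "R = D / (1 - c)"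
  have R: "0 \<le> R" "D + c * R = R" using D(1) c_less by (auto simp: R_def field_simps)
  have ball: "dist x y \<le> R" if "y \<in> ifs_orbit N g x" for y
    using that
  proof induction
    case (step y i)
    have "dist x (g i y) \<le> dist x (g i x) + dist (g i x) (g i y)" by (rule dist_triangle)
    also have "\<dots> \<le> D + c * dist x y" using D(2) contr step by (intro add_mono)
    also have "\<dots> \<le> D + c * R" using step c_pos by simp
    finally show ?case using R by simp
  qed (use R in auto)
  have "\<exists>k. finite k \<and> ifs_orbit N g x \<subseteq> (\<Union>a\<in>k. cball a (c ^ n * R))" for n
  proof (induction n)
    case 0
    show ?case using ball by (intro exI [of _ "{x}"]) auto
  next
    case (Suc n)
    then obtain k where k: "finite k" "ifs_orbit N g x \<subseteq> (\<Union>a\<in>k. cball a (c ^ n * R))" by blast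
    define k' where "k' = insert x (\<Union>i<N. g i ` k)"
    have "\<exists>a\<in>k'. dist a y \<le> c ^ Suc n * R" if "y \<in> ifs_orbit N g x" for y
      using that
    proof cases
      case base
      then show ?thesis using R(1) c_pos by (auto simp: k'_def)
    next
      case (step z i)
      then obtain a where a: "a \<in> k" "dist a z \<le> c ^ n * R" using k(2) by auto
      have "dist (g i a) (g i z) \<le> c * dist a z" using contr step by blast
      also have "\<dots> \<le> c * (c ^ n * R)" using a c_pos by simp
      finally show ?thesis using a(1) step by (auto simp: k'_def mult.assoc)
    qed
    then have "ifs_orbit N g x \<subseteq> (\<Union>a\<in>k'. cball a (c ^ Suc n * R))" by auto
    moreover have "finite k'" using k(1) by (simp add: k'_def)
    ultimately show ?case by blast
  qed
  then show ?thesis by blast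
qed

lemma compact_closure_ifs_orbit: "compact (closure (ifs_orbit N g x))"
proof -
  obtain R where R: "\<And>n. \<exists>k. finite k \<and> ifs_orbit N g x \<subseteq> (\<Union>a\<in>k. cball a (c ^ n * R))"
    using ifs_orbit_covered by metis
  have "\<exists>k. finite k \<and> closure (ifs_orbit N g x) \<subseteq> (\<Union>a\<in>k. ball a \<epsilon>)" if pos: "\<epsilon> > 0" for \<epsilon>
  proof -
    obtain n where n: "c ^ n * R < \<epsilon>" using small_power [OF pos] by blast
    obtain k where k: "finite k" "ifs_orbit N g x \<subseteq> (\<Union>a\<in>k. cball a (c ^ n * R))"
      using R by blast
    have "closure (ifs_orbit N g x) \<subseteq> (\<Union>a\<in>k. cball a (c ^ n * R))"
      using k by (intro closure_minimal closed_UN) auto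
    also have "\<dots> \<subseteq> (\<Union>a\<in>k. ball a \<epsilon>)" using n by force
    finally show ?thesis using k(1) by blast
  qed
  then show ?thesis
    unfolding compact_eq_totally_bounded by (auto simp: complete_eq_closed)
qed

lemma closure_ifs_orbit_step:
  assumes "i < N" "y \<in> closure (ifs_orbit N g x)"
  shows "g i y \<in> closure (ifs_orbit N g x)"
proof -
  have "g i ` closure (ifs_orbit N g x) \<subseteq> closure (ifs_orbit N g x)"
    using assms(1)
    by (intro image_closure_subset continuous_g) (auto intro: ifs_orbit.step subsetD [OF closure_subset])
  then show ?thesis using assms(2) by blast
qed

end

section \<open>Existence of minimal compact invariant sets\<close>

lemma minimal_compact_invariant_sets_iff:
  fixes M :: "'t::t2_space set"
  shows "M \<in> minimal_compact_invariant_sets N \<nu> g \<longleftrightarrow>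
    M \<noteq> {} \<and> compact M \<and> invariant_set N \<nu> g M \<and>
    (\<forall>M'. M' \<noteq> {} \<longrightarrow> closed M' \<longrightarrow> invariant_set N \<nu> g M' \<longrightarrow> M' \<subseteq> M \<longrightarrow> M' = M)"
  unfolding minimal_compact_invariant_sets_def minimal_set_def
  by (auto dest: compact_imp_closed)

text \<open>Zorn's lemma for reverse inclusion. Chains have bounds because nonempty closed subsets
  of the compact set \<open>C\<close> that form a chain have nonempty intersection.\<close>

lemma minimal_compact_invariant_set_exists:
  fixes C :: "'t::t2_space set"
  assumes C: "compact C" "C \<noteq> {}" "invariant_set N \<nu> g C"
  shows "\<exists>M\<in>minimal_compact_invariant_sets N \<nu> g. M \<subseteq> C"
proof -
  define F where "F = {M. M \<noteq> {} \<and> closed M \<and> invariant_set N \<nu> g M \<and> M \<subseteq> C}"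
  have "C \<in> F" using C by (auto simp: F_def compact_imp_closed)
  \<comment> \<open>Complements turn reverse inclusion into the order of
    \<open>subset_Zorn\<close>.\<close>
  have "\<exists>U\<in>uminus ` F. \<forall>X\<in>\<C>. X \<subseteq> U" if ch: "subset.chain (uminus ` F) \<C>" for \<C>
  proof (cases "\<C> = {}")
    case True
    then show ?thesis using \<open>C \<in> F\<close> by blast
  next
    case False
    define G where "G = uminus ` \<C>"
    have G: "G \<subseteq> F" "G \<noteq> {}" using ch False by (auto simp: G_def subset.chain_def)
    have lin: "A \<subseteq> B \<or> B \<subseteq> A" if "A \<in> G" "B \<in> G" for A B
      using ch that unfolding G_def subset_chain_def by blast
    have fin: "C \<inter> \<Inter>F' \<noteq> {}" if "finite F'" "F' \<subseteq> G" for F'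
    proof (cases "F' = {}")
      case True
      then show ?thesis using C(2) by simp
    next
      case False
      \<comment> \<open>A finite nonempty chain contains its own intersection, which is therefore
        nonempty like every member of \<open>F\<close>.\<close>
      then have "\<Inter>F' \<in> F'"
        using that lin by (intro Inter_in_chain) (auto simp: subset.chain_def)
      then have "\<Inter>F' \<in> F" using that G by blast
      then show ?thesis by (auto simp: F_def)
    qed
    have closed: "closed M" if "M \<in> G" for M
      using that G(1) by (auto simp: F_def)
    have "C \<inter> \<Inter>G \<noteq> {}"
      by (rule compact_imp_fip [OF C(1) closed fin])
    moreover have "closed (\<Inter>G)" using closed by blast
    moreover have "invariant_set N \<nu> g (\<Inter>G)"
      using G(1) unfolding F_def invariant_set_def by blast
    moreover have "\<Inter>G \<subseteq> C" using G unfolding F_def by blast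
    ultimately have "\<Inter>G \<in> F" unfolding F_def by blast
    moreover have "\<forall>X\<in>\<C>. X \<subseteq> - \<Inter>G" by (auto simp: G_def)
    ultimately show ?thesis by blast
  qed
  then obtain U where "U \<in> uminus ` F" "\<forall>X\<in>uminus ` F. U \<subseteq> X \<longrightarrow> X = U"
    using subset_Zorn [of "uminus ` F"] by blast
  then obtain M where M: "M \<in> F" "\<And>M'. M' \<in> F \<Longrightarrow> M' \<subseteq> M \<Longrightarrow> M' = M"
    by (metis Compl_subset_Compl_iff double_complement imageE imageI)
  have "compact M" using compact_Int_closed [OF C(1), of M] M(1) by (simp add: F_def Int_absorb1)
  moreover have "M' = M" if "M' \<noteq> {}" "closed M'" "invariant_set N \<nu> g M'" "M' \<subseteq> M" for M'
    using that M by (auto simp: F_def)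
  ultimately have "M \<in> minimal_compact_invariant_sets N \<nu> g"
    using M(1) by (auto simp: minimal_compact_invariant_sets_iff F_def)
  then show ?thesis using M(1) by (auto simp: F_def)
qed

section \<open>The spaces of minimal sets\<close>

lemma word_op_Nil [simp]: "word_op S [] x = x"
  and word_op_Cons [simp]: "word_op S (i # \<omega>) x = S i (word_op S \<omega> x)"
  by (simp_all add: word_op_def)

lemma separate_compact:
  fixes A B :: "'t::metric_space set"
  assumes "compact A" "compact B" "A \<inter> B = {}"
  obtains d where "0 < d" "\<And>x y. x \<in> A \<Longrightarrow> y \<in> B \<Longrightarrow> d \<le> dist x y"
proof (cases "A \<times> B = {}")
  case True
  then show ?thesis using that [of 1] by auto
next
  case False
  have "continuous_on (A \<times> B) (\<lambda>p. dist (fst p) (snd p))"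
    by (intro continuous_intros)
  from continuous_attains_inf [OF compact_Times [OF assms(1,2)] False this]
  obtain a b where ab: "a \<in> A" "b \<in> B" "\<And>x y. x \<in> A \<Longrightarrow> y \<in> B \<Longrightarrow> dist a b \<le> dist x y"
    by fastforce
  then show ?thesis using that [of "dist a b"] assms(3) by auto
qed

text \<open>The hypotheses expressed in \<open>H\<close> alone: on \<open>K\<close> the adjoint of
  \<open>V i\<close> is \<open>T i\<close>, so (A2) becomes \<open>T_e\<close>, and \<open>K\<close>
  enters only as the closed span of the vectors \<open>e t\<close>.\<close>

locale contractive_system = cuntz_representation N H S + uniform_contractions N g c
  for N :: nat and H :: "'h::chilbert_space set" and S and g :: "nat \<Rightarrow> 't::complete_space \<Rightarrow> 't" and c +
  fixes e :: "'t \<Rightarrow> 'h" and \<nu> :: "nat \<Rightarrow> 't \<Rightarrow> complex"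
  assumes cont_e: "continuous_on UNIV e" and e_in: "e t \<in> H" and norm_e: "norm (e t) = 1"
    and T_e: "i < N \<Longrightarrow> T i (e t) = \<nu> i t *\<^sub>C e (g i t)"
    and cyclic: "cyclic N H S (closed_cspan (range e))"
begin

abbreviation "invar \<equiv> invariant_set N \<nu> g"
abbreviation "HM \<equiv> H_space N S e"
abbreviation "\<M> \<equiv> minimal_compact_invariant_sets N \<nu> g"

section \<open>The subspaces attached to invariant sets\<close>

lemma closed_csubspace_HM: "closed_csubspace (HM M)"
  by (simp add: H_space_def closed_csubspace_closed_cspan)

lemmas subspace_HM = closed_csubspaceD(1) [OF closed_csubspace_HM]

lemma word_op_in_HM: "t \<in> M \<Longrightarrow> \<omega> \<in> lists {..<N} \<Longrightarrow> word_op S \<omega> (e t) \<in> HM M"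
  unfolding H_space_def by (rule subsetD [OF closed_cspan_superset]) auto

lemma e_in_HM: "t \<in> M \<Longrightarrow> e t \<in> HM M"
  using word_op_in_HM [of t M "[]"] by simp

text \<open>Serves as an induction principle: a property that defines a closed subspace stable under
  all \<open>S i\<close> passes from the vectors \<open>e t\<close> to all of
  \<open>HM M\<close>.\<close>

lemma HM_minimal:
  assumes "closed_csubspace D" "\<And>t. t \<in> M \<Longrightarrow> e t \<in> D" "\<And>i x. i < N \<Longrightarrow> x \<in> D \<Longrightarrow> S i x \<in> D"
  shows "HM M \<subseteq> D"
proof -
  have "word_op S \<omega> (e t) \<in> D" if "\<omega> \<in> lists {..<N}" "t \<in> M" for t \<omega>
    using that by (induction \<omega>) (use assms in auto)
  then show ?thesis
    unfolding H_space_def by (intro closed_cspan_minimal assms) auto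
qed

lemma HM_subset_H: "HM M \<subseteq> H"
  using closed_csubspace_H e_in bounded_opD(1) [OF bounded_op_S] by (intro HM_minimal) auto

lemma S_in_HM:
  assumes i: "i < N" and x: "x \<in> HM M"
  shows "S i x \<in> HM M"
proof -
  have "word_op S \<omega> (e t) \<in> {x\<in>H. S i x \<in> HM M}" if "\<omega> \<in> lists {..<N}" "t \<in> M" for t \<omega>
    using that word_op_in_HM [of t M \<omega>] word_op_in_HM [of t M "i # \<omega>"] HM_subset_H i by auto
  then have "HM M \<subseteq> {x\<in>H. S i x \<in> HM M}"
    unfolding H_space_def [of N S e M]
    by (intro closed_cspan_minimal closed_csubspace_vimage [OF bounded_op_S [OF i]]
        closed_csubspace_H closed_csubspace_closed_cspan) (auto simp: H_space_def)
  then show ?thesis using x by blast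
qed

lemma T_e_in:
  assumes "invar M" "t \<in> M" "i < N" "complex_vector.subspace D" "\<And>t. t \<in> M \<Longrightarrow> e t \<in> D"
  shows "T i (e t) \<in> D"
\<comment> \<open>If the weight vanishes, \<open>g i t\<close> may lie outside \<open>M\<close>, but
  then \<open>T i (e t) = 0\<close>.\<close>
proof (cases "\<nu> i t = 0")
  case True
  then show ?thesis using assms by (simp add: T_e complex_vector.subspace_0)
next
  case False
  then have "g i t \<in> M" using assms by (simp add: invariant_set_def)
  then show ?thesis using assms by (simp add: T_e complex_vector.subspace_scale)
qed

lemma T_in_HM:
  assumes M: "invar M" and i: "i < N" and x: "x \<in> HM M"
  shows "T i x \<in> HM M"
proof -
  \<comment> \<open>Membership in \<open>HM M\<close> is carried along because
    \<open>T i (S j x)\<close> is \<open>x\<close> itself when \<open>i = j\<close>.\<close>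
  define D where "D = HM M \<inter> {x\<in>H. T i x \<in> HM M}"
  have D: "closed_csubspace D"
    unfolding D_def
    by (intro closed_csubspace_Int closed_csubspace_HM closed_csubspace_H
        closed_csubspace_vimage [OF bounded_op_T [OF i]])
  have "HM M \<subseteq> D"
  proof (rule HM_minimal [OF D])
    show "e t \<in> D" if "t \<in> M" for t
      using that T_e_in [OF M that i subspace_HM e_in_HM] by (simp add: D_def e_in e_in_HM)
    show "S j x \<in> D" if "j < N" "x \<in> D" for j x
      using that T_S [OF \<open>j < N\<close> i, of x] bounded_opD(1) [OF bounded_op_S, of j x]
      by (auto simp: D_def S_in_HM complex_vector.subspace_0 [OF subspace_HM])
  qed
  then show ?thesis using x by (auto simp: D_def)
qed

lemma invariant_subspace_HM: "invar M \<Longrightarrow> invariant_subspace N H S (HM M)"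
  by (simp add: invariant_subspace_def closed_csubspace_HM HM_subset_H S_in_HM T_in_HM)

section \<open>Kernels of intertwiners\<close>

lemma kernel_expansion:
  assumes X: "invariant_subspace N H S X" and W: "bounded_op X Y W" "Y \<subseteq> H"
    and WS: "\<And>i x. i < N \<Longrightarrow> x \<in> X \<Longrightarrow> W (S i x) = S i (W x)"
    and WT: "\<And>i x. i < N \<Longrightarrow> x \<in> X \<Longrightarrow> W (T i x) = T i (W x)"
    and s: "e s \<in> X"
  shows "cinner (W (e s)) (e t)
    = (\<Sum>i<N. \<nu> i s * cnj (\<nu> i t) * cinner (W (e (g i s))) (e (g i t)))"
proof -
  note XD = invariant_subspaceD [OF X]
  \<comment> \<open>Expand \<open>e s\<close> by the Cuntz relation, pull \<open>S i\<close> through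
    \<open>W\<close>, and move it onto \<open>e t\<close> as \<open>T i\<close>; then
    \<open>T_e\<close> evaluates both arguments.\<close>
  have "W (e s) = W (\<Sum>i<N. S i (T i (e s)))"
    using s XD by (simp add: sum_S_T subset_iff)
  also have "\<dots> = (\<Sum>i<N. S i (W (T i (e s))))"
    using s XD by (subst bounded_op_sum [OF W(1)]) (simp_all add: WS)
  finally have "cinner (W (e s)) (e t) = (\<Sum>i<N. cinner (S i (W (T i (e s)))) (e t))"
    by (simp add: cinner.sum_left)
  also have "\<dots> = (\<Sum>i<N. \<nu> i s * cnj (\<nu> i t) * cinner (W (e (g i s))) (e (g i t)))"
  proof (rule sum.cong)
    fix i assume "i \<in> {..<N}"
    then have i: "i < N" by simp
    have TX: "T i (e s) \<in> X" using i s XD by simp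
    then have "W (T i (e s)) \<in> H" using bounded_opD(1) [OF W(1)] W(2) by blast
    then have *: "cinner (S i (W (T i (e s)))) (e t) = cnj (\<nu> i t) * cinner (W (T i (e s))) (e (g i t))"
      using i by (simp add: cinner_S T_e cinner_scaleC_right)
    \<comment> \<open>\<open>W\<close> is controlled only on \<open>X\<close>. A nonzero weight puts
      \<open>e (g i s)\<close> into \<open>X\<close>, as a multiple of \<open>T i (e s)\<close>; a
      zero weight removes the term.\<close>
    have "W (T i (e s)) = \<nu> i s *\<^sub>C W (e (g i s))"
    proof (cases "\<nu> i s = 0")
      case True
      then show ?thesis using i bounded_op_0 [OF W(1) s] by (simp add: T_e)
    next
      case False
      have "inverse (\<nu> i s) *\<^sub>C T i (e s) = e (g i s)"
        using False i by (simp add: T_e)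
      then have "e (g i s) \<in> X" using complex_vector.subspace_scale [OF XD(2) TX] by metis
      then show ?thesis using i by (simp add: T_e bounded_opD(3) [OF W(1)])
    qed
    then show "cinner (S i (W (T i (e s)))) (e t)
        = \<nu> i s * cnj (\<nu> i t) * cinner (W (e (g i s))) (e (g i t))"
      unfolding * by (simp add: cinner_scaleC_left)
  qed simp
  finally show ?thesis .
qed

text \<open>The expansion for \<open>W = id\<close> and \<open>s = t\<close>, where all diagonal
  values are 1. The squared moduli are thus transition probabilities.\<close>

lemma sum_nu: "(\<Sum>i<N. (cmod (\<nu> i t))\<^sup>2) = 1"
proof -
  have "bounded_op H H id"
    unfolding bounded_op_def by (auto intro!: exI [of _ 1])
  from kernel_expansion [OF invariant_subspace_H this _ _ _ e_in, of t t]
  have "complex_of_real 1 = (\<Sum>i<N. \<nu> i t * cnj (\<nu> i t))"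
    by (simp add: cinner_self_eq_norm norm_e)
  also have "\<dots> = complex_of_real (\<Sum>i<N. (cmod (\<nu> i t))\<^sup>2)"
    by (simp only: complex_norm_square [symmetric] of_real_sum)
  finally show ?thesis by (simp only: of_real_eq_iff)
qed

lemma nu_nonzero_exists: "\<exists>i<N. \<nu> i t \<noteq> 0"
proof (rule ccontr)
  assume "\<not> ?thesis"
  then have "(\<Sum>i<N. (cmod (\<nu> i t))\<^sup>2) = 0" by auto
  then show False using sum_nu [of t] by simp
qed

text \<open>The arithmetic-geometric mean inequality for each product, then \<open>sum_nu\<close>
  for both points.\<close>

lemma sum_nu_nu_le: "(\<Sum>i<N. cmod (\<nu> i s) * cmod (\<nu> i t)) \<le> 1"
proof -
  have "(\<Sum>i<N. cmod (\<nu> i s) * cmod (\<nu> i t))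
      \<le> (\<Sum>i<N. ((cmod (\<nu> i s))\<^sup>2 + (cmod (\<nu> i t))\<^sup>2) / 2)"
  proof (rule sum_mono)
    fix i
    show "cmod (\<nu> i s) * cmod (\<nu> i t) \<le> ((cmod (\<nu> i s))\<^sup>2 + (cmod (\<nu> i t))\<^sup>2) / 2"
      using sum_squares_bound [of "cmod (\<nu> i s)" "cmod (\<nu> i t)"] by simp
  qed
  also have "\<dots> = 1"
    by (simp add: sum.distrib sum_nu flip: sum_divide_distrib)
  finally show ?thesis .
qed

text \<open>The coefficients have absolute sum at most 1, so a bound on \<open>F\<close> after the
  transitions passes back to \<open>F s t\<close>; finitely many contractions bring any pair within
  the range of \<open>near\<close>.\<close>

lemma kernel_vanishes:
  assumes M: "invar M" and M': "invar M'"
    and expand: "\<And>s t. s \<in> M \<Longrightarrow> t \<in> M' \<Longrightarrow>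
        F s t = (\<Sum>i<N. \<nu> i s * cnj (\<nu> i t) * F (g i s) (g i t))"
    and near: "\<And>\<epsilon>. 0 < \<epsilon> \<Longrightarrow>
        \<exists>\<delta>>0. \<forall>s\<in>M. \<forall>t\<in>M'. dist s t < \<delta> \<longrightarrow> cmod (F s t) \<le> \<epsilon>"
    and st: "s \<in> M" "t \<in> M'"
  shows "F s t = 0"
proof -
  have "cmod (F s t) \<le> \<epsilon>" if \<epsilon>: "0 < \<epsilon>" for \<epsilon>
  proof -
    obtain \<delta> where "0 < \<delta>" and \<delta>: "\<And>s t. s \<in> M \<Longrightarrow> t \<in> M' \<Longrightarrow> dist s t < \<delta> \<Longrightarrow> cmod (F s t) \<le> \<epsilon>"
      using near [OF \<epsilon>] by blast
    \<comment> \<open>Here \<open>n\<close> counts the transitions that suffice to bring the pair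
      closer than \<delta>.\<close>
    have step: "s \<in> M \<Longrightarrow> t \<in> M' \<Longrightarrow> c ^ n * dist s t < \<delta> \<Longrightarrow> cmod (F s t) \<le> \<epsilon>" for n s t
    proof (induction n arbitrary: s t)
      case 0
      then show ?case by (simp add: \<delta>)
    next
      case (Suc n)
      have "cmod (\<nu> i s * cnj (\<nu> i t) * F (g i s) (g i t)) \<le> cmod (\<nu> i s) * cmod (\<nu> i t) * \<epsilon>"
        if i: "i < N" for i
      proof (cases "\<nu> i s = 0 \<or> \<nu> i t = 0")
        case False
        then have "g i s \<in> M" "g i t \<in> M'"
          using Suc.prems M M' i by (auto simp: invariant_set_def)
        moreover have "c ^ n * dist (g i s) (g i t) \<le> c ^ n * (c * dist s t)"
          using contr [OF i] c_pos by (intro mult_left_mono) auto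
        then have "c ^ n * dist (g i s) (g i t) < \<delta>"
          using Suc.prems by (simp add: mult_ac)
        ultimately have "cmod (F (g i s) (g i t)) \<le> \<epsilon>" by (rule Suc.IH)
        then show ?thesis by (simp add: norm_mult mult_left_mono)
      qed auto
      then have "cmod (F s t) \<le> (\<Sum>i<N. cmod (\<nu> i s) * cmod (\<nu> i t) * \<epsilon>)"
        using Suc.prems by (subst expand) (auto intro!: sum_norm_le)
      also have "\<dots> = (\<Sum>i<N. cmod (\<nu> i s) * cmod (\<nu> i t)) * \<epsilon>"
        by (simp add: sum_distrib_right)
      also have "\<dots> \<le> 1 * \<epsilon>" using \<epsilon> sum_nu_nu_le by (intro mult_right_mono) auto
      finally show ?case by simp
    qed
    obtain n where "c ^ n * dist s t < \<delta>" using small_power [OF \<open>0 < \<delta>\<close>] by blast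
    then show ?thesis using step st by blast
  qed
  then have "cmod (F s t) \<le> 0" by (rule dense_ge)
  then show ?thesis by simp
qed

text \<open>After \<open>kernel_vanishes\<close> has settled the pairs \<open>e s\<close>,
  \<open>e t\<close>, the result is extended in two stages. First in \<open>x\<close>: an
  \<open>S i\<close> becomes \<open>T i\<close> on \<open>e t\<close>, which yields a multiple of
  some \<open>e\<close> over \<open>M'\<close> or zero. Then in \<open>y\<close>: an
  \<open>S i\<close> becomes \<open>T i\<close> on \<open>W x\<close>, that is
  \<open>W (T i x)\<close>.\<close>

lemma intertwiner_vanishes:
  assumes M: "invar M" and M': "invar M'"
    and W: "bounded_op (HM M) Y W" "Y \<subseteq> H"
    and WS: "\<And>i x. i < N \<Longrightarrow> x \<in> HM M \<Longrightarrow> W (S i x) = S i (W x)"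
    and WT: "\<And>i x. i < N \<Longrightarrow> x \<in> HM M \<Longrightarrow> W (T i x) = T i (W x)"
    and near: "\<And>\<epsilon>. 0 < \<epsilon> \<Longrightarrow>
        \<exists>\<delta>>0. \<forall>s\<in>M. \<forall>t\<in>M'. dist s t < \<delta> \<longrightarrow> cmod (cinner (W (e s)) (e t)) \<le> \<epsilon>"
    and x: "x \<in> HM M" and y: "y \<in> HM M'"
  shows "cinner (W x) y = 0"
proof -
  have WH: "W x \<in> H" if "x \<in> HM M" for x
    using that bounded_opD(1) [OF W(1)] W(2) by blast
  have ee: "cinner (W (e s)) (e t) = 0" if "s \<in> M" "t \<in> M'" for s t
    using kernel_expansion [OF invariant_subspace_HM [OF M] W WS WT e_in_HM] near that
    by (intro kernel_vanishes [OF M M']) auto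
  define A where "A = {z\<in>H. \<forall>w\<in>e ` M'. cinner z w = 0}"
  have A: "closed_csubspace A"
    unfolding A_def Collect_conj_eq by (intro closed_csubspace_Int closed_csubspace_ortho) (simp add: closed_csubspace_H)
  define D where "D = {x\<in>HM M. W x \<in> A}"
  have D: "closed_csubspace D"
    unfolding D_def by (intro closed_csubspace_vimage [OF W(1)] closed_csubspace_HM A)
  have "HM M \<subseteq> D"
  proof (rule HM_minimal [OF D])
    show "e s \<in> D" if "s \<in> M" for s
      using that ee e_in_HM WH by (auto simp: D_def A_def)
    fix i x assume i: "i < N" and x: "x \<in> D"
    have "cinner (S i (W x)) (e t) = 0" if "t \<in> M'" for t
    proof -
      \<comment> \<open>\<open>T_e_in\<close> is applied to the orthogonal complement of
        \<open>W x\<close>, which contains all \<open>e t\<close> with \<open>t\<close> in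
        \<open>M'\<close>.\<close>
      have "T i (e t) \<in> {z. \<forall>w\<in>{W x}. cinner z w = 0}"
        using x by (intro T_e_in [OF M' that i] closed_csubspaceD closed_csubspace_ortho)
          (auto simp: D_def A_def cinner_eq_0_commute [of _ "W x"])
      then have "cinner (W x) (T i (e t)) = 0"
        using cinner_eq_0_commute by blast
      then show ?thesis using i x WH by (simp add: cinner_S D_def)
    qed
    then show "S i x \<in> D"
      using i x WS WH S_in_HM [OF i, of x M] by (auto simp: D_def A_def simp flip: WS)
  qed
  then have We: "cinner (W x) (e t) = 0" if "x \<in> HM M" "t \<in> M'" for x t
    using that by (auto simp: D_def A_def)
  define D' where "D' = H \<inter> {y. \<forall>w\<in>W ` HM M. cinner y w = 0}"
  have D': "closed_csubspace D'"
    unfolding D'_def by (intro closed_csubspace_Int closed_csubspace_ortho closed_csubspace_H)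
  have "HM M' \<subseteq> D'"
  proof (rule HM_minimal [OF D'])
    show "e t \<in> D'" if "t \<in> M'" for t
      using that We e_in by (auto simp: D'_def cinner_eq_0_commute [of "e t"])
    fix i y assume i: "i < N" and y: "y \<in> D'"
    have "cinner (S i y) (W x) = 0" if "x \<in> HM M" for x
    proof -
      have "cinner (S i y) (W x) = cinner y (W (T i x))"
        using i y that by (simp add: cinner_S D'_def WT)
      then show ?thesis using y T_in_HM [OF M i that] by (auto simp: D'_def)
    qed
    then show "S i y \<in> D'"
      using i y bounded_opD(1) [OF bounded_op_S] by (auto simp: D'_def)
  qed
  then have "cinner y (W x) = 0" using x y by (auto simp: D'_def)
  then show ?thesis by (subst cinner_eq_0_commute)
qed

section \<open>Orthogonality and disjointness for distinct minimal sets\<close>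

lemma minimal_setD:
  assumes "M \<in> \<M>"
  shows "M \<noteq> {}" "compact M" "invar M"
    and "M' \<noteq> {} \<Longrightarrow> closed M' \<Longrightarrow> invar M' \<Longrightarrow> M' \<subseteq> M \<Longrightarrow> M' = M"
  using assms by (auto simp: minimal_compact_invariant_sets_iff)

lemma minimal_sets_disjoint:
  assumes "M \<in> \<M>" "M' \<in> \<M>" "M \<noteq> M'"
  shows "M \<inter> M' = {}"
proof (rule ccontr)
  assume ne: "M \<inter> M' \<noteq> {}"
  have "closed (M \<inter> M')" "invar (M \<inter> M')"
    using minimal_setD [OF assms(1)] minimal_setD [OF assms(2)]
    by (auto simp: invariant_set_def intro!: closed_Int compact_imp_closed)
  then have "M \<inter> M' = M" "M \<inter> M' = M'"
    using minimal_setD(4) [OF assms(1) ne] minimal_setD(4) [OF assms(2) ne] by auto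
  then show False using assms(3) by simp
qed

lemma intertwiner_distinct_vanishes:
  assumes MM: "M \<in> \<M>" "M' \<in> \<M>" "M \<noteq> M'"
    and W: "bounded_op (HM M) Y W" "Y \<subseteq> H"
    and WS: "\<And>i x. i < N \<Longrightarrow> x \<in> HM M \<Longrightarrow> W (S i x) = S i (W x)"
    and WT: "\<And>i x. i < N \<Longrightarrow> x \<in> HM M \<Longrightarrow> W (T i x) = T i (W x)"
    and "x \<in> HM M" "y \<in> HM M'"
  shows "cinner (W x) y = 0"
proof -
  note MD = minimal_setD [OF MM(1)] and MD' = minimal_setD [OF MM(2)]
  obtain d where d: "0 < d" "\<And>s t. s \<in> M \<Longrightarrow> t \<in> M' \<Longrightarrow> d \<le> dist s t"
    using separate_compact [OF MD(2) MD'(2) minimal_sets_disjoint [OF MM]] by blast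
  then have "\<exists>\<delta>>0. \<forall>s\<in>M. \<forall>t\<in>M'. dist s t < \<delta> \<longrightarrow> cmod (cinner (W (e s)) (e t)) \<le> \<epsilon>" for \<epsilon>
    by (intro exI [of _ d]) fastforce
  from intertwiner_vanishes [OF MD(3) MD'(3) W WS WT this assms(8,9)] show ?thesis .
qed

lemma HM_orthogonal:
  assumes "M \<in> \<M>" "M' \<in> \<M>" "M \<noteq> M'" "x \<in> HM M" "y \<in> HM M'"
  shows "cinner x y = 0"
proof -
  have "bounded_op (HM M) (HM M) id"
    unfolding bounded_op_def by (auto intro!: exI [of _ 1])
  from intertwiner_distinct_vanishes [OF assms(1-3) this HM_subset_H _ _ assms(4,5)]
  show ?thesis by simp
qed

lemma HM_disjoint_reps:
  assumes "M \<in> \<M>" "M' \<in> \<M>" "M \<noteq> M'"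
  shows "disjoint_reps N (HM M) S (HM M') S"
  unfolding disjoint_reps_def
proof (rule notI, elim exE conjE)
  fix W assume W: "bounded_op (HM M) (HM M') W" "\<exists>x\<in>HM M. W x \<noteq> 0"
    and comm: "\<forall>i<N. \<forall>x\<in>HM M. W (S i x) = S i (W x) \<and> W (adj (HM M) (S i) x) = adj (HM M') (S i) (W x)"
  have adj: "adj (HM M) (S i) x = T i x" if "M \<in> \<M>" "i < N" "x \<in> HM M" for M i x
    using that by (intro adj_invariant_subspace invariant_subspace_HM minimal_setD(3))
  have "W x = 0" if x: "x \<in> HM M" for x
  proof -
    have Wx: "W x \<in> HM M'" using bounded_opD(1) [OF W(1) x] .
    \<comment> \<open>\<open>W x\<close> may be tested against itself since it lies in
      \<open>HM M'\<close>; by \<open>adj\<close> the relative adjoints in \<open>comm\<close> are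
      all \<open>T i\<close>.\<close>
    have "cinner (W x) (W x) = 0"
      using comm adj assms bounded_opD(1) [OF W(1)]
      by (intro intertwiner_distinct_vanishes [OF assms W(1) HM_subset_H _ _ x Wx]) auto
    then show ?thesis by (simp add: cinner_self_eq_0_iff)
  qed
  then show False using W(2) by blast
qed

section \<open>The maximum principle\<close>

lemma max_principle:
  fixes h :: "'t \<Rightarrow> real"
  assumes C: "compact C" "C \<noteq> {}" "invar C" and cont: "continuous_on C h"
    and harm: "\<And>t. h t = (\<Sum>i<N. (cmod (\<nu> i t))\<^sup>2 * h (g i t))"
  shows "\<exists>m. \<exists>M\<in>\<M>. M \<subseteq> C \<and> (\<forall>t\<in>M. h t = m) \<and> (\<forall>t\<in>C. h t \<le> m)"
proof -
  obtain t0 where t0: "t0 \<in> C" "\<And>t. t \<in> C \<Longrightarrow> h t \<le> h t0"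
    using continuous_attains_sup [OF C(1,2) cont] by blast
  define B where "B = {t\<in>C. h t = h t0}"
  have "closed B"
    unfolding B_def
    by (intro continuous_closed_preimage_constant cont compact_imp_closed C)
  then have "compact B"
    using compact_Int_closed [OF C(1), of B] by (simp add: B_def Int_absorb1)
  moreover have "B \<noteq> {}" using t0 by (auto simp: B_def)
  moreover have "invar B"
    unfolding invariant_set_def
  proof (intro ballI allI impI)
    fix t i assume t: "t \<in> B" and i: "i < N" "\<nu> i t \<noteq> 0"
    have gC: "g j t \<in> C" if "j < N" "\<nu> j t \<noteq> 0" for j
      using that t C(3) by (auto simp: B_def invariant_set_def)
    \<comment> \<open>Where the weight vanishes, \<open>g j t\<close> may leave \<open>C\<close> and
      the bound by \<open>h t0\<close> may fail, but the product is zero.\<close>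
    have nonneg: "0 \<le> (cmod (\<nu> j t))\<^sup>2 * (h t0 - h (g j t))" if "j < N" for j
      using t0(2) [OF gC [OF that]] by (cases "\<nu> j t = 0") auto
    \<comment> \<open>At a maximum point the probability-weighted gaps to the maximum add up to
      zero. None is negative, so transitions of nonzero weight lead to maximum points.\<close>
    have "(\<Sum>j<N. (cmod (\<nu> j t))\<^sup>2 * (h t0 - h (g j t)))
        = (\<Sum>j<N. (cmod (\<nu> j t))\<^sup>2) * h t0 - (\<Sum>j<N. (cmod (\<nu> j t))\<^sup>2 * h (g j t))"
      by (simp add: right_diff_distrib sum_subtractf sum_distrib_right)
    also have "\<dots> = 0" using t harm [of t] by (simp add: sum_nu B_def)
    finally have "(cmod (\<nu> i t))\<^sup>2 * (h t0 - h (g i t)) = 0"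
      using nonneg i by (subst (asm) sum_nonneg_eq_0_iff) auto
    then show "g i t \<in> B" using i gC by (simp add: B_def)
  qed
  ultimately obtain M where "M \<in> \<M>" "M \<subseteq> B"
    using minimal_compact_invariant_set_exists by blast
  then show ?thesis using t0(2) by (intro exI [of _ "h t0"] bexI [of _ M]) (auto simp: B_def)
qed

text \<open>\<open>cproj L\<close> commutes with the representation, so
  \<open>kernel_expansion\<close> on the diagonal makes the squared norm harmonic.\<close>

lemma cproj_max_principle:
  assumes L: "invariant_subspace N H S L" and C: "compact C" "C \<noteq> {}" "invar C"
  shows "\<exists>m. \<exists>M\<in>\<M>. M \<subseteq> C \<and> (\<forall>t\<in>M. (norm (cproj L (e t)))\<^sup>2 = m) \<and> (\<forall>t\<in>C. (norm (cproj L (e t)))\<^sup>2 \<le> m)"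
proof (rule max_principle [OF C])
  note LD = invariant_subspaceD [OF L]
  have P: "bounded_op H H (cproj L)" by (rule bounded_op_cproj [OF LD(1,3)])
  have "continuous_on UNIV (\<lambda>t. cproj L (e t))"
    using e_in by (intro continuous_on_compose2 [OF bounded_op_continuous [OF P subspace_H] cont_e]) auto
  then show "continuous_on C (\<lambda>t. (norm (cproj L (e t)))\<^sup>2)"
    by (intro continuous_intros) (rule continuous_on_subset, auto)
  fix t
  have "complex_of_real ((norm (cproj L (e t)))\<^sup>2)
      = (\<Sum>i<N. \<nu> i t * cnj (\<nu> i t) * complex_of_real ((norm (cproj L (e (g i t))))\<^sup>2))"
    using kernel_expansion [OF invariant_subspace_H P _ cproj_commute [OF L] e_in, of t t]
    by (simp only: cinner_cproj [OF LD(1)] subset_refl)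
  also have "\<dots> = complex_of_real (\<Sum>i<N. (cmod (\<nu> i t))\<^sup>2 * (norm (cproj L (e (g i t))))\<^sup>2)"
    by (simp only: complex_norm_square [symmetric] of_real_sum of_real_mult)
  finally show "(norm (cproj L (e t)))\<^sup>2 = (\<Sum>i<N. (cmod (\<nu> i t))\<^sup>2 * (norm (cproj L (e (g i t))))\<^sup>2)"
    by (simp only: of_real_eq_iff)
qed

lemma HM_irreducible:
  assumes M: "M \<in> \<M>"
  shows "irreducible_rep N (HM M) S"
  unfolding irreducible_rep_def
proof (intro conjI allI impI)
  note MD = minimal_setD [OF M]
  note X = invariant_subspace_HM [OF MD(3)]
  show "cuntz_rep N (HM M) S" by (rule cuntz_rep_invariant_subspace [OF X])
  fix L assume L0: "invariant_subspace N (HM M) S L"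
  note L = invariant_subspace_trans [OF X L0]
  note LD = invariant_subspaceD [OF L]
  have LX: "L \<subseteq> HM M" using L0 by (simp add: invariant_subspace_def)
  obtain m M' where M': "M' \<in> \<M>" "M' \<subseteq> M" "\<And>t. t \<in> M' \<Longrightarrow> (norm (cproj L (e t)))\<^sup>2 = m"
    using cproj_max_principle [OF L MD(2,1,3)] by blast
  \<comment> \<open>By minimality the maximum is attained on all of \<open>M\<close>, so the
    diagonal is constant.\<close>
  have "M' = M"
    using minimal_setD [OF M'(1)] M'(2) by (intro MD(4)) (auto intro: compact_imp_closed)
  then have m: "cinner (cproj L (e t)) (e t) = complex_of_real m" if "t \<in> M" for t
    using M'(3) that by (simp add: cinner_cproj [OF LD(1)])
  define W where "W x = cproj L x - complex_of_real m *\<^sub>C x" for x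
  have P: "bounded_op H H (cproj L)" by (rule bounded_op_cproj [OF LD(1,3)])
  have normW: "norm (W x) \<le> (1 + \<bar>m\<bar>) * norm x" for x
  proof -
    have "norm (W x) \<le> norm (cproj L x) + norm (complex_of_real m *\<^sub>C x)"
      unfolding W_def by (rule norm_triangle_ineq4)
    then show ?thesis using norm_cproj_le [OF LD(1), of x] by (simp add: norm_scaleC algebra_simps)
  qed
  have inX: "x \<in> H" if "x \<in> HM M" for x using that HM_subset_H by blast
  have W: "bounded_op (HM M) H W"
    unfolding bounded_op_def
  proof (intro conjI ballI allI image_subsetI exI)
    fix x y a assume x: "x \<in> HM M"
    show "W x \<in> H"
      unfolding W_def using bounded_opD(1) [OF P] inX [OF x]
      by (intro complex_vector.subspace_diff complex_vector.subspace_scale subspace_H) auto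
    show "norm (W x) \<le> (1 + \<bar>m\<bar>) * norm x" by (rule normW)
    show "W (a *\<^sub>C x) = a *\<^sub>C W x"
      using inX [OF x] by (simp add: W_def bounded_opD(3) [OF P] scaleC.diff_right scaleC_scaleC mult.commute)
    assume y: "y \<in> HM M"
    show "W (x + y) = W x + W y"
      using inX [OF x] inX [OF y] by (simp add: W_def bounded_opD(2) [OF P] scaleC_add_right)
  qed
  have WS: "W (S i x) = S i (W x)" if "i < N" "x \<in> HM M" for i x
    using that inX bounded_opD(1) [OF P] unfolding W_def
    by (subst bounded_op_diff [OF bounded_op_S subspace_H])
      (auto simp: complex_vector.subspace_scale [OF subspace_H] cproj_commute [OF L] bounded_opD(3) [OF bounded_op_S])
  have WT: "W (T i x) = T i (W x)" if "i < N" "x \<in> HM M" for i x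
    using that inX bounded_opD(1) [OF P] unfolding W_def
    by (subst bounded_op_diff [OF bounded_op_T subspace_H])
      (auto simp: complex_vector.subspace_scale [OF subspace_H] cproj_commute [OF L] bounded_opD(3) [OF bounded_op_T])
  \<comment> \<open>The choice of \<open>m\<close> makes the kernel of \<open>W\<close> vanish on
    the diagonal. Uniform continuity of \<open>e\<close> on the compact set \<open>M\<close> and the
    bound \<open>normW\<close> extend this to smallness for nearby pairs.\<close>
  have near: "\<exists>\<delta>>0. \<forall>s\<in>M. \<forall>t\<in>M. dist s t < \<delta> \<longrightarrow> cmod (cinner (W (e s)) (e t)) \<le> \<epsilon>"
    if \<epsilon>: "0 < \<epsilon>" for \<epsilon>
  proof -
    have "uniformly_continuous_on M e"
      using cont_e MD(2) by (intro compact_uniformly_continuous) (auto intro: continuous_on_subset)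
    moreover have "0 < \<epsilon> / (1 + \<bar>m\<bar>)" using \<epsilon> by simp
    ultimately obtain \<delta> where "0 < \<delta>"
      and \<delta>: "\<And>s t. s \<in> M \<Longrightarrow> t \<in> M \<Longrightarrow> dist t s < \<delta> \<Longrightarrow> dist (e t) (e s) < \<epsilon> / (1 + \<bar>m\<bar>)"
      unfolding uniformly_continuous_on_def by metis
    have "cmod (cinner (W (e s)) (e t)) \<le> \<epsilon>" if "s \<in> M" "t \<in> M" "dist s t < \<delta>" for s t
    proof -
      have "cinner (W (e s)) (e s) = 0"
        using m [OF that(1)]
        by (simp add: W_def cinner.diff_left cinner_scaleC_left cinner_self_eq_norm norm_e)
      then have "cinner (W (e s)) (e t) = cinner (W (e s)) (e t - e s)"
        by (simp add: cinner.diff_right)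
      then have "cmod (cinner (W (e s)) (e t)) \<le> norm (W (e s)) * norm (e t - e s)"
        by (simp add: norm_cinner_le)
      also have "\<dots> \<le> (1 + \<bar>m\<bar>) * (\<epsilon> / (1 + \<bar>m\<bar>))"
        using normW [of "e s"] \<delta> [of s t] that
        by (intro mult_mono) (auto simp: norm_e dist_norm dist_commute)
      also have "\<dots> = \<epsilon>" by simp
      finally show ?thesis .
    qed
    then show ?thesis using \<open>0 < \<delta>\<close> by blast
  qed
  have W0: "W x = 0" if x: "x \<in> HM M" for x
  proof -
    have "W x \<in> HM M"
      unfolding W_def using x cproj_in [OF LD(1)] LX
      by (intro complex_vector.subspace_diff complex_vector.subspace_scale subspace_HM) auto
    then have "cinner (W x) (W x) = 0"
      by (intro intertwiner_vanishes [OF MD(3) MD(3) W _ WS WT near x]) auto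
    then show ?thesis by (simp add: cinner_self_eq_0_iff)
  qed
  \<comment> \<open>On \<open>HM M\<close> the projection onto \<open>L\<close> is the scalar
    \<open>m\<close>. A nonzero vector of \<open>L\<close> is fixed by it, so \<open>m = 1\<close>,
    and then all of \<open>HM M\<close> is fixed.\<close>
  show "L = {0} \<or> L = HM M"
  proof (cases "L = {0}")
    case False
    then obtain z where z: "z \<in> L" "z \<noteq> 0"
      using complex_vector.subspace_0 [OF LD(2)] by blast
    have "z = complex_of_real m *\<^sub>C z"
      using W0 [of z] z LX by (auto simp: W_def cproj_ident [OF LD(1)])
    then have "(1 - complex_of_real m) *\<^sub>C z = 0"
      by (simp add: scaleC.diff_left)
    then have "complex_of_real m = 1" using z(2) by simp
    then have "x \<in> L" if "x \<in> HM M" for x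
      using W0 [OF that] cproj_in [OF LD(1), of x] by (simp add: W_def)
    then show ?thesis using LX by blast
  qed simp
qed

lemma HM_total:
  assumes x: "x \<in> H" "\<And>M y. M \<in> \<M> \<Longrightarrow> y \<in> HM M \<Longrightarrow> cinner x y = 0"
  shows "x = 0"
proof -
  define L where "L = {x\<in>H. \<forall>y\<in>(\<Union>M\<in>\<M>. HM M). cinner x y = 0}"
  have L: "invariant_subspace N H S L"
    unfolding L_def
    by (rule invariant_subspace_ortho)
      (use HM_subset_H in \<open>auto intro: S_in_HM T_in_HM minimal_setD(3)\<close>)
  note LD = invariant_subspaceD [OF L]
  have e0: "cproj L (e t) = 0" for t
  proof -
    define C where "C = closure (ifs_orbit N g t)"
    have t: "t \<in> C" unfolding C_def by (rule subsetD [OF closure_subset ifs_orbit.base])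
    have "compact C" "invar C"
      by (auto simp: C_def compact_closure_ifs_orbit closure_ifs_orbit_step invariant_set_def)
    then obtain m M where M: "M \<in> \<M>" "\<And>s. s \<in> M \<Longrightarrow> (norm (cproj L (e s)))\<^sup>2 = m"
      and m: "\<And>s. s \<in> C \<Longrightarrow> (norm (cproj L (e s)))\<^sup>2 \<le> m"
      using cproj_max_principle [OF L, of C] t by blast
    obtain s where s: "s \<in> M" using minimal_setD(1) [OF M(1)] by blast
    \<comment> \<open>\<open>L\<close> is orthogonal to \<open>HM M\<close>, which contains
      \<open>e s\<close>. The maximum \<open>m\<close> over the orbit closure is therefore
      zero.\<close>
    have "cinner (cproj L (e s)) (e s) = 0"
      using cproj_in [OF LD(1), of "e s"] M(1) e_in_HM [OF s] by (auto simp: L_def)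
    then have "m = 0" using M(2) [OF s] by (simp add: cinner_cproj [OF LD(1)])
    then show ?thesis using m [OF t] by simp
  qed
  \<comment> \<open>The complement of \<open>L\<close> contains every \<open>e t\<close>, so by
    cyclicity it is \<open>H\<close>; then \<open>x\<close> is orthogonal to itself.\<close>
  define D where "D = {x\<in>H. \<forall>y\<in>L. cinner x y = 0}"
  have D: "invariant_subspace N H S D"
    unfolding D_def using LD by (intro invariant_subspace_ortho) auto
  have "cinner (e t) y = 0" if "y \<in> L" for t y
    using cinner_diff_cproj [OF LD(1) that, of "e t"] by (simp add: e0)
  then have "closed_cspan (range e) \<subseteq> D"
    using e_in by (intro closed_cspan_minimal invariant_subspaceD(1) [OF D]) (auto simp: D_def)
  then have "D = H" by (rule cyclic_invariant_subspace [OF cyclic D])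
  moreover have "x \<in> L" using x by (auto simp: L_def)
  ultimately have "cinner x x = 0" using x(1) by (auto simp: D_def)
  then show ?thesis by (simp add: cinner_self_eq_0_iff)
qed

text \<open>A path of possible transitions inside \<open>M\<close> and its companion path from
  \<open>x\<close> under the same maps approach each other. By compactness the two sets meet, and
  minimality absorbs \<open>M\<close> into the orbit closure. All minimal sets thus share one
  compact set.\<close>

lemma minimal_set_subset_attractor:
  assumes M: "M \<in> \<M>"
  shows "M \<subseteq> closure (ifs_orbit N g x)"
proof -
  let ?A = "closure (ifs_orbit N g x)"
  note MD = minimal_setD [OF M]
  obtain t where t: "t \<in> M" using MD(1) by blast
  have x: "x \<in> ?A" by (rule subsetD [OF closure_subset ifs_orbit.base])
  have approach: "\<exists>s\<in>M. \<exists>y\<in>?A. dist s y \<le> c ^ n * dist t x" for n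
  proof (induction n)
    case 0
    show ?case using t x by auto
  next
    case (Suc n)
    then obtain s y where sy: "s \<in> M" "y \<in> ?A" "dist s y \<le> c ^ n * dist t x" by blast
    \<comment> \<open>The map is selected at \<open>s\<close>, to stay in \<open>M\<close>;
      \<open>y\<close> can follow because \<open>?A\<close> is stable under every
      \<open>g i\<close>, whatever the weight at \<open>y\<close>.\<close>
    obtain i where i: "i < N" "\<nu> i s \<noteq> 0" using nu_nonzero_exists by blast
    have "g i s \<in> M" using MD(3) sy i by (simp add: invariant_set_def)
    moreover have "g i y \<in> ?A" by (rule closure_ifs_orbit_step [OF i(1) sy(2)])
    moreover have "dist (g i s) (g i y) \<le> c ^ Suc n * dist t x"
    proof -
      have "dist (g i s) (g i y) \<le> c * dist s y" by (rule contr [OF i(1)])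
      also have "\<dots> \<le> c * (c ^ n * dist t x)" using sy(3) c_pos by simp
      finally show ?thesis by (simp add: mult.assoc)
    qed
    ultimately show ?case by blast
  qed
  have ne: "M \<inter> ?A \<noteq> {}"
  proof
    assume "M \<inter> ?A = {}"
    then obtain d where "0 < d" and d: "\<And>s y. s \<in> M \<Longrightarrow> y \<in> ?A \<Longrightarrow> d \<le> dist s y"
      using separate_compact [OF MD(2) compact_closure_ifs_orbit] by blast
    obtain n where n: "c ^ n * dist t x < d" using small_power [OF \<open>0 < d\<close>] by blast
    obtain s y where "s \<in> M" "y \<in> ?A" "dist s y \<le> c ^ n * dist t x" using approach by blast
    then show False using d [of s y] n by linarith
  qed
  have "invar (M \<inter> ?A)"
    using MD(3) closure_ifs_orbit_step by (auto simp: invariant_set_def)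
  then have "M \<inter> ?A = M"
    using MD(2) by (intro MD(4) ne closed_Int compact_imp_closed) auto
  then show ?thesis by blast
qed

lemma finite_minimal_sets: "finite \<M>"
proof -
  \<comment> \<open>The base point is arbitrary: each orbit closure contains all minimal
    sets.\<close>
  define C where "C = closure (ifs_orbit N g undefined)"
  have "compact (e ` C)"
    using cont_e compact_closure_ifs_orbit unfolding C_def
    by (intro compact_continuous_image) (auto intro: continuous_on_subset)
  moreover have "0 < (1/2::real)" by simp
  \<comment> \<open>Radius \<open>1/2\<close> puts points of the same ball at distance below 1,
    whereas orthonormal vectors have squared distance 2. Each ball thus serves at most one minimal
    set.\<close>
  ultimately obtain k where k: "finite k" "e ` C \<subseteq> (\<Union>a\<in>k. ball a (1/2))"
    unfolding compact_eq_totally_bounded by blast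
  have "\<exists>a\<in>k. \<exists>t\<in>M. dist a (e t) < 1/2" if M: "M \<in> \<M>" for M
  proof -
    obtain t where "t \<in> M" using minimal_setD(1) [OF M] by blast
    then show ?thesis
      using minimal_set_subset_attractor [OF M, of undefined] k(2) unfolding C_def by fastforce
  qed
  then obtain a t where at: "\<And>M. M \<in> \<M> \<Longrightarrow> a M \<in> k \<and> t M \<in> M \<and> dist (a M) (e (t M)) < 1/2"
    by metis
  have "M = M'" if M: "M \<in> \<M>" "M' \<in> \<M>" "a M = a M'" for M M'
  proof (rule ccontr)
    assume "M \<noteq> M'"
    then have "cinner (e (t M)) (e (t M')) = 0"
      using at M by (intro HM_orthogonal [of M M']) (auto intro: e_in_HM)
    then have "inner (e (t M)) (e (t M')) = 0" by (simp add: inner_eq_Re_cinner)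
    then have "(dist (e (t M)) (e (t M')))\<^sup>2 = 2"
      using norm_e [of "t M"] norm_e [of "t M'"]
      by (simp add: dist_norm power2_norm_eq_inner norm_eq_1 inner_diff_left inner_diff_right inner_commute)
    moreover have "dist (e (t M)) (e (t M')) < 1"
      using at [OF M(1)] at [OF M(2)] M(3) dist_triangle_half_r [of "a M" "e (t M)" 1 "e (t M')"] by simp
    then have "(dist (e (t M)) (e (t M')))\<^sup>2 < 1" by (simp add: power_less_one_iff abs_square_less_1)
    ultimately show False by simp
  qed
  then have "inj_on a \<M>" by (auto intro: inj_onI)
  moreover have "a ` \<M> \<subseteq> k" using at by blast
  ultimately show ?thesis using k(1) by (metis finite_imageD finite_subset)
qed

text \<open>The components of \<open>y\<close> are its projections: the difference between
  \<open>y\<close> and their sum is orthogonal to every \<open>HM M\<close>, hence zero by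
  \<open>HM_total\<close>.\<close>

lemma HM_direct_sum: "orthogonal_direct_sum \<M> HM H"
  unfolding orthogonal_direct_sum_def
proof (intro conjI ballI impI)
  show "finite \<M>" by (rule finite_minimal_sets)
  show "closed_csubspace (HM M)" "HM M \<subseteq> H" for M
    by (rule closed_csubspace_HM, rule HM_subset_H)
  show "cinner x y = 0" if "M \<in> \<M>" "M' \<in> \<M>" "M \<noteq> M'" "x \<in> HM M" "y \<in> HM M'" for M M' x y
    using that by (rule HM_orthogonal)
  fix y assume y: "y \<in> H"
  \<comment> \<open>Pairing with a vector of \<open>HM M\<close> isolates the component at
    \<open>M\<close>; this serves both existence and uniqueness.\<close>
  have pick: "cinner (\<Sum>M\<in>\<M>. f M) z = cinner (f M) z"
    if "f \<in> (\<Pi>\<^sub>E M\<in>\<M>. HM M)" "M \<in> \<M>" "z \<in> HM M" for f M z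
  proof -
    have "cinner (f M') z = 0" if "M' \<in> \<M> - {M}" for M'
      using that \<open>M \<in> \<M>\<close> \<open>z \<in> HM M\<close> \<open>f \<in> _\<close> by (intro HM_orthogonal [of M' M]) auto
    then show ?thesis
      using that(2) finite_minimal_sets
      by (simp add: sum.remove [of _ M] cinner.add_left cinner.sum_left)
  qed
  \<comment> \<open>The restricted abstraction is \<open>undefined\<close> off the index set, as
    extensional functions must be for uniqueness.\<close>
  define p where "p = (\<lambda>M\<in>\<M>. cproj (HM M) y)"
  have p: "p \<in> (\<Pi>\<^sub>E M\<in>\<M>. HM M)"
    by (auto simp: p_def cproj_in [OF closed_csubspace_HM])
  show "\<exists>!f. f \<in> (\<Pi>\<^sub>E M\<in>\<M>. HM M) \<and> y = (\<Sum>M\<in>\<M>. f M)"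
  proof (rule ex1I [of _ p], intro conjI p)
    have "y - (\<Sum>M\<in>\<M>. p M) = 0"
    proof (rule HM_total)
      show "y - (\<Sum>M\<in>\<M>. p M) \<in> H"
        using y p HM_subset_H
        by (intro complex_vector.subspace_diff complex_vector.subspace_sum subspace_H) auto
      show "cinner (y - (\<Sum>M\<in>\<M>. p M)) z = 0" if "M \<in> \<M>" "z \<in> HM M" for M z
        using cinner_diff_cproj [OF closed_csubspace_HM that(2), of y] that pick [OF p that]
        by (simp add: cinner.diff_left p_def)
    qed
    then show "y = (\<Sum>M\<in>\<M>. p M)" by simp
    fix f assume f: "f \<in> (\<Pi>\<^sub>E M\<in>\<M>. HM M) \<and> y = (\<Sum>M\<in>\<M>. f M)"
    show "f = p"
    proof (rule PiE_ext)
      show "f \<in> (\<Pi>\<^sub>E M\<in>\<M>. HM M)" "p \<in> (\<Pi>\<^sub>E M\<in>\<M>. HM M)" using f p by auto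
      fix M assume M: "M \<in> \<M>"
      have "cproj (HM M) y = f M"
      proof (rule cproj_eqI [OF closed_csubspace_HM])
        show "f M \<in> HM M" using f M by auto
        show "cinner (y - f M) z = 0" if "z \<in> HM M" for z
          using pick [of f M z] f M that by (simp add: cinner.diff_left)
      qed
      then show "f M = p M" using M by (simp add: p_def)
    qed
  qed
qed

lemma T_in_K_space:
  assumes M: "invar M" and i: "i < N" and x: "x \<in> K_space e M"
  shows "T i x \<in> K_space e M"
proof -
  have K: "closed_csubspace (K_space e M)"
    by (simp add: K_space_def closed_csubspace_closed_cspan)
  have eK: "e t \<in> K_space e M" if "t \<in> M" for t
    unfolding K_space_def using that by (intro subsetD [OF closed_cspan_superset]) simp
  have "K_space e M \<subseteq> {x\<in>H. T i x \<in> K_space e M}"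
    unfolding K_space_def [of e M]
    using T_e_in [OF M _ i closed_csubspaceD(1) [OF K] eK] e_in
    by (intro closed_cspan_minimal closed_csubspace_vimage [OF bounded_op_T [OF i]] closed_csubspace_H
        closed_csubspace_closed_cspan) (auto simp: K_space_def)
  then show ?thesis using x by blast
qed

end

theorem theorem3p5:
  fixes N :: nat
    and K H :: "'h::chilbert_space set"
    and V S :: "nat \<Rightarrow> 'h \<Rightarrow> 'h"
    and e :: "'t::complete_space \<Rightarrow> 'h"
    and \<nu> :: "nat \<Rightarrow> 't \<Rightarrow> complex"
    and g :: "nat \<Rightarrow> 't \<Rightarrow> 't"
  assumes "N \<ge> 2"
    and "row_coisometry N K V"
    and "cuntz_dilation N K V H S"
    and A1: "continuous_on UNIV e" "\<And>t. e t \<in> K" "closed_cspan (range e) = K" "\<And>t. norm (e t) = 1"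
    and A2: "\<And>i t. i < N \<Longrightarrow> adj K (V i) (e t) = \<nu> i t *\<^sub>C e (g i t)"
    and A3: "\<And>i. i < N \<Longrightarrow> contraction (g i)"
  shows "let \<M> = minimal_compact_invariant_sets N \<nu> g in
    finite \<M>
    \<and> (\<forall>M\<in>\<M>. \<forall>i<N. \<forall>x\<in>K_space e M. adj K (V i) x \<in> K_space e M)
    \<and> (\<forall>M\<in>\<M>. invariant_subspace N H S (H_space N S e M))
    \<and> orthogonal_direct_sum \<M> (H_space N S e) H
    \<and> (\<forall>M\<in>\<M>. irreducible_rep N (H_space N S e M) S)
    \<and> (\<forall>M\<in>\<M>. \<forall>M'\<in>\<M>. M \<noteq> M' \<longrightarrow>
         disjoint_reps N (H_space N S e M) S (H_space N S e M') S)"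
proof -
  obtain c where c: "0 < c" "c < 1" "\<And>i x y. i < N \<Longrightarrow> dist (g i x) (g i y) \<le> c * dist x y"
    by (rule contraction_uniform [OF A3]) auto
  have dil: "cuntz_rep N H S" "K \<subseteq> H" "cyclic N H S K"
    and adj: "\<And>i x. i < N \<Longrightarrow> x \<in> K \<Longrightarrow> adj K (V i) x = adj H (S i) x"
    using assms(3) by (auto simp: cuntz_dilation_def)
  interpret contractive_system N H S g c e \<nu>
  proof unfold_locales
    show "e t \<in> H" for t using A1(2) dil(2) by blast
    show "adj H (S i) (e t) = \<nu> i t *\<^sub>C e (g i t)" if "i < N" for i t
      using A2 [OF that] adj [OF that A1(2)] by simp
    show "cyclic N H S (closed_cspan (range e))" using dil(3) A1(3) by simp
  qed (use c dil A1 in auto)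
  \<comment> \<open>Inside \<open>K\<close> the adjoint of \<open>V i\<close> coincides with that of
    \<open>S i\<close>, so \<open>T_in_K_space\<close> transfers to it.\<close>
  have K: "K_space e M \<subseteq> K" for M
    unfolding K_space_def using A1(2) assms(2)
    by (intro closed_cspan_minimal) (auto simp: row_coisometry_def)
  have "adj K (V i) x \<in> K_space e M" if "M \<in> \<M>" "i < N" "x \<in> K_space e M" for M i x
    using that T_in_K_space [OF minimal_setD(3) [OF that(1)] that(2,3)] adj [OF that(2) subsetD [OF K that(3)]] by simp
  then show ?thesis
    unfolding Let_def
    using finite_minimal_sets invariant_subspace_HM minimal_setD(3) HM_direct_sum HM_irreducible
      HM_disjoint_reps
    by (intro conjI ballI allI impI) auto
qed

end
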